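(* Let $T\subset\mathbb{R}^n$ be a linear subspace, $S\subset T^\perp$ a convex set, and let $f:\mathbb{R}^n\to\mathbb{R}$ be convex and continuously differentiable. Let $x^0\in T\oplus S$ be such that $\mathcal{P}_T^\perp x^0$ is a vertex of $S$, and assume: (1) $S$ is a bounded polyhedron; (2) the level set $X^0=\{x\in\mathbb{R}^n: f(x)\le f(x^0)\}$ is bounded; (3) $f$ is $L$-smooth over $\bar S\oplus T$, where $\bar S:=S+(S-S)=\{x+(y-z): x,y,z\in S\}$; (4) $f$ is $\mu$-strongly convex on $S\oplus T$ with respect to $\|\cdot\|_2$ (with $\mu>0$). Let $\{(x^k,y^k)\}_{k\ge0}$ be the sequence generated by the unbounded Away-Step Frank-Wolfe method (uAFW) started at $x^0$ with gradient step-size $\eta\le 1/L$, let $f^*$ be the optimal objective value of $\min\{f(x):x\in T\oplus S\}$, and let $\sigma=\mu\,\psi(S)^2/4$. Then for all $k\ge 0$, $$f(y^k)-f^*\le\left(1-\min\left\{\frac12,\frac{\sigma}{\bar C_{f,x^0}^S}\right\}\frac{\mu\eta}{4}\right)^{k/2}\big(f(y^0)-f^*\big).$$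
   Context: $T\oplus S=\{t+s:t\in T,s\in S\}$; $\mathcal{P}_T,\mathcal{P}_T^\perp$ are the orthogonal projections onto $T,T^\perp$. $f$ is $L$-smooth over $Q$ if it is differentiable and $\|\nabla f(u)-\nabla f(v)\|_2\le L\|u-v\|_2$ for all $u,v\in Q$. $f$ is $\mu$-strongly convex on a convex set $X$ w.r.t. $\|\cdot\|$ if $f(y)-f(x)-\langle\nabla f(x),y-x\rangle\ge\frac{\mu}{2}\|y-x\|^2$ for all $x,y\in X$. Curvature constant: $\bar C_{f,x^0}^S=\sup\big\{\frac{2}{\alpha^2}(f(y)-f(x)-\langle\nabla f(x),y-x\rangle): s\in S,\ x,y\in\mathbb{R}^n,\ \alpha\in[-1,1]\setminus\{0\},\ \mathcal{P}_T^\perp x\in S,\ f(x)\le f(x^0),\ y=x+\alpha(s-\mathcal{P}_T^\perp x)\big\}$. Facial distance: $\psi(S)=\min\{\mathrm{dist}(F,\mathrm{conv}(V(S)\setminus F)): F\text{ a face of }S,\ \emptyset\ne F\ne S\}$, where $V(S)$ is the set of vertices of $S$, $V(S)\setminus F=V(S)\cap F^c$, and dist is Euclidean distance. (If $S$ is a single point, $\min\{1/2,\sigma/\bar C_{f,x^0}^S\}$ is read as $1/2$.) uAFW algorithm. It maintains a set $V(x^k)$ of vertices of $S$ and weights $\lambda_v(x^k)$, $v\in V(x^k)$, with $\mathcal{P}_T^\perp x^k=\sum_{v\in V(x^k)}\lambda_v(x^k)v$ and $\sum_v\lambda_v(x^k)=1$. Initially $V(x^0)=\{\mathcal{P}_T^\perp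 x^0\}$ with weight $1$; $\eta>0$. For $k=0,1,2,\dots$: (1) $y^k=x^k-\eta\,\mathcal{P}_T\nabla f(x^k)$. (2) $s^k\in\arg\min_{s\in S}\langle\nabla f(y^k),s\rangle$ (taken to be a vertex of $S$), $v^k\in\arg\max_{v\in V(x^k)}\langle\nabla f(y^k),v\rangle$. (3) If $\langle\nabla f(y^k),s^k-\mathcal{P}_T^\perp x^k\rangle<\langle\nabla f(y^k),\mathcal{P}_T^\perp x^k-v^k\rangle$ (Frank-Wolfe step): $d^k=s^k-\mathcal{P}_T^\perp x^k$, $\alpha_{\max}=1$. Otherwise (away step): $d^k=\mathcal{P}_T^\perp x^k-v^k$, $\alpha_{\max}=\lambda_{v^k}(x^k)/(1-\lambda_{v^k}(x^k))$ (read as $+\infty$ if $\lambda_{v^k}(x^k)=1$, in which case $d^k=0$ and $\alpha_k$ is any finite value). (4) $x^{k+1}=y^k+\alpha_kd^k$ with $\alpha_k\in\arg\min_{\alpha\in[0,\alpha_{\max}]}f(y^k+\alpha d^k)$ (exact line search). (5) Updates. Frank-Wolfe step: $V(x^{k+1})=\{s^k\}$ if $\alpha_k=1$, otherwise $V(x^{k+1})=V(x^k)\cup\{s^k\}$; $\lambda_{s^k}(x^{k+1})=(1-\alpha_k)\lambda_{s^k}(x^k)+\alpha_k$ (with $\lambda_{s^k}(x^k)=0$ if $s^k\notin V(x^k)$), and $\lambda_v(x^{k+1})=(1-\alpha_k)\lambda_v(x^k)$ for $v\in V(x^k)\setminus\{s^k\}$. Away step: $V(x^{k+1})=V(x^k)\setminus\{v^k\}$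 if $\alpha_k=\alpha_{\max}$, otherwise $V(x^{k+1})=V(x^k)$; $\lambda_{v^k}(x^{k+1})=(1+\alpha_k)\lambda_{v^k}(x^k)-\alpha_k$, and $\lambda_v(x^{k+1})=(1+\alpha_k)\lambda_v(x^k)$ for $v\in V(x^k)\setminus\{v^k\}$. *)

theory Defs
  imports "HOL-Analysis.Analysis" "HOL-Library.Set_Algebras"
begin

text \<open>
  Minkowski sums are written \<open>A + B\<close> (theory Set_Algebras).  Note that \<open>A - B\<close> remains the
  set-theoretic difference, so the set \<open>S + (S - S)\<close> of the mathematical text is spelled out below.
\<close>

definition gradient :: "('a::real_inner \<Rightarrow> real) \<Rightarrow> 'a \<Rightarrow> 'a" where
  "gradient f x = (THE D. GDERIV f x :> D)"

lemma gradient_eqI: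
  assumes "GDERIV f x :> D"
  shows "gradient f x = D"
  unfolding gradient_def
proof (rule the_equality)
  show "E = D" if "GDERIV f x :> E" for E
  proof -
    have "(\<lambda>h. h \<bullet> E) = (\<lambda>h. h \<bullet> D)"
      using has_derivative_unique that assms unfolding gderiv_def by blast
    then have "\<forall>h. h \<bullet> (E - D) = 0"
      by (metis inner_diff_right right_minus_eq)
    then show "E = D"
      by (metis inner_eq_zero_iff right_minus_eq)
  qed
qed (fact assms)

definition continuously_differentiable :: "('a::real_inner \<Rightarrow> real) \<Rightarrow> bool" where
  "continuously_differentiable f \<longleftrightarrow>
     (\<forall>x. f differentiable (at x)) \<and> continuous_on UNIV (gradient f)"

definition smooth_over :: "real \<Rightarrow> 'a::real_inner set \<Rightarrow> ('a \<Rightarrow> real) \<Rightarrow> bool" where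
  "smooth_over L Q f \<longleftrightarrow>
     (\<forall>u\<in>Q. f differentiable (at u)) \<and>
     (\<forall>u\<in>Q. \<forall>v\<in>Q. norm (gradient f u - gradient f v) \<le> L * norm (u - v))"

definition strongly_convex_on :: "real \<Rightarrow> 'a::real_inner set \<Rightarrow> ('a \<Rightarrow> real) \<Rightarrow> bool" where
  "strongly_convex_on \<mu> X f \<longleftrightarrow>
     convex X \<and>
     (\<forall>x\<in>X. \<forall>y\<in>X. f y - f x - gradient f x \<bullet> (y - x) \<ge> \<mu> / 2 * (norm (y - x))\<^sup>2)"

definition orth_proj :: "'a::euclidean_space set \<Rightarrow> 'a \<Rightarrow> 'a" where
  "orth_proj T x = (THE p. p \<in> T \<and> x - p \<in> T\<^sup>\<bottom>)"

definition vertices :: "'a::real_vector set \<Rightarrow> 'a set" where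
  "vertices S = {v. v extreme_point_of S}"

text \<open>
  Faces are the convex-geometric faces of the library (\<open>face_of\<close>).  A polytope has finitely many of
  them, and one with more than one point has a face other than \<open>{}\<close> and \<open>S\<close>, so \<open>Min\<close> is applied to
  a finite nonempty set.  For a one-point \<open>S\<close> the value is meaningless.
\<close>
definition facial_distance :: "'a::euclidean_space set \<Rightarrow> real" where
  "facial_distance S =
     Min {setdist F (convex hull (vertices S - F)) | F. F face_of S \<and> F \<noteq> {} \<and> F \<noteq> S}"

text \<open>
  The supremum is a real one.  If \<open>f\<close> is \<open>L\<close>-smooth over \<open>(S + (S - S)) + T\<close> with \<open>S\<close> convex and
  bounded, both \<open>x\<close> and \<open>y\<close> lie in that set and the quotients are bounded by \<open>L\<close> times the squared
  diameter of \<open>S\<close>, so the supremum is finite; the set is nonempty if the projection of \<open>x0\<close> is in \<open>S\<close>.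
\<close>
definition curvature_const ::
  "'a::euclidean_space set \<Rightarrow> 'a set \<Rightarrow> ('a \<Rightarrow> real) \<Rightarrow> 'a \<Rightarrow> real" where
  "curvature_const T S f x0 =
     Sup {2 / \<alpha>\<^sup>2 * (f y - f x - gradient f x \<bullet> (y - x)) | s x y \<alpha>.
            s \<in> S \<and> \<alpha> \<in> {-1..1} - {0} \<and> orth_proj (T\<^sup>\<bottom>) x \<in> S \<and> f x \<le> f x0 \<and>
            y = x + \<alpha> *\<^sub>R (s - orth_proj (T\<^sup>\<bottom>) x)}"

definition exact_line_search ::
  "('a::real_vector \<Rightarrow> real) \<Rightarrow> 'a \<Rightarrow> 'a \<Rightarrow> ereal \<Rightarrow> real \<Rightarrow> bool" where
  "exact_line_search f y d amax \<alpha> \<longleftrightarrow>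
     is_arg_min (\<lambda>a. f (y + a *\<^sub>R d)) (\<lambda>a. 0 \<le> a \<and> ereal a \<le> amax) \<alpha>"

definition frank_wolfe_update ::
  "('a::real_vector \<Rightarrow> real) \<Rightarrow> 'a \<Rightarrow> 'a \<Rightarrow> 'a \<Rightarrow>
   'a set \<Rightarrow> ('a \<Rightarrow> real) \<Rightarrow> 'a \<Rightarrow> 'a set \<Rightarrow> ('a \<Rightarrow> real) \<Rightarrow> bool" where
  "frank_wolfe_update f y p s V w x' V' w' \<longleftrightarrow>
     (\<exists>\<alpha>. exact_line_search f y (s - p) 1 \<alpha> \<and>
          x' = y + \<alpha> *\<^sub>R (s - p) \<and>
          V' = (if \<alpha> = 1 then {s} else V \<union> {s}) \<and>
          w' s = (1 - \<alpha>) * (if s \<in> V then w s else 0) + \<alpha> \<and>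
          (\<forall>u \<in> V - {s}. w' u = (1 - \<alpha>) * w u))"

text \<open>
  If the away vertex \<open>v\<close> has weight 1, then \<open>p = v\<close>, the direction vanishes, the maximal step size is
  infinite, and every \<open>\<alpha> \<ge> 0\<close> passes the line search.
\<close>
definition away_update ::
  "('a::real_vector \<Rightarrow> real) \<Rightarrow> 'a \<Rightarrow> 'a \<Rightarrow> 'a \<Rightarrow>
   'a set \<Rightarrow> ('a \<Rightarrow> real) \<Rightarrow> 'a \<Rightarrow> 'a set \<Rightarrow> ('a \<Rightarrow> real) \<Rightarrow> bool" where
  "away_update f y p v V w x' V' w' \<longleftrightarrow>
     (\<exists>\<alpha> amax. amax = (if w v = 1 then \<infinity> else ereal (w v / (1 - w v))) \<and>
          exact_line_search f y (p - v) amax \<alpha> \<and>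
          x' = y + \<alpha> *\<^sub>R (p - v) \<and>
          V' = (if ereal \<alpha> = amax then V - {v} else V) \<and>
          w' v = (1 + \<alpha>) * w v - \<alpha> \<and>
          (\<forall>u \<in> V - {v}. w' u = (1 + \<alpha>) * w u))"

text \<open>
  One iteration takes the iterate \<open>x\<close>, its active vertex set \<open>V\<close> and the weights \<open>w\<close> on \<open>V\<close> to
  \<open>x'\<close>, \<open>V'\<close>, \<open>w'\<close> through the intermediate point \<open>y\<close>.  It is a relation because the two oracles
  and the line search may have several solutions.  Weights outside the active set are unspecified
  and never used.
\<close>
definition uafw_step ::
  "'a::euclidean_space set \<Rightarrow> 'a set \<Rightarrow> ('a \<Rightarrow> real) \<Rightarrow> real \<Rightarrow>
   'a \<Rightarrow> 'a set \<Rightarrow> ('a \<Rightarrow> real) \<Rightarrow> 'a \<Rightarrow> 'a \<Rightarrow> 'a set \<Rightarrow> ('a \<Rightarrow> real) \<Rightarrow> bool" where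
  "uafw_step T S f \<eta> x V w y x' V' w' \<longleftrightarrow>
     y = x - \<eta> *\<^sub>R orth_proj T (gradient f x) \<and>
     (\<exists>s v p. p = orth_proj (T\<^sup>\<bottom>) x \<and>
        s \<in> vertices S \<and>
        is_arg_min (\<lambda>z. gradient f y \<bullet> z) (\<lambda>z. z \<in> S) s \<and>
        is_arg_max (\<lambda>z. gradient f y \<bullet> z) (\<lambda>z. z \<in> V) v \<and>
        (if gradient f y \<bullet> (s - p) < gradient f y \<bullet> (p - v)
         then frank_wolfe_update f y p s V w x' V' w'
         else away_update f y p v V w x' V' w'))"

definition uafw_sequence ::
  "'a::euclidean_space set \<Rightarrow> 'a set \<Rightarrow> ('a \<Rightarrow> real) \<Rightarrow> real \<Rightarrow> 'a \<Rightarrow>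
   (nat \<Rightarrow> 'a) \<Rightarrow> (nat \<Rightarrow> 'a) \<Rightarrow> bool" where
  "uafw_sequence T S f \<eta> x0 x y \<longleftrightarrow>
     (\<exists>V w. x 0 = x0 \<and>
        V 0 = {orth_proj (T\<^sup>\<bottom>) x0} \<and>
        w 0 (orth_proj (T\<^sup>\<bottom>) x0) = 1 \<and>
        (\<forall>k. uafw_step T S f \<eta> (x k) (V k) (w k) (y k) (x (Suc k)) (V (Suc k)) (w (Suc k))))"

end

theory Submission
  imports Defs
begin

text \<open>
  The proof bounds the gap \<open>h = f (y k) - fstar\<close> against two sources of decrease per iteration.
  Write \<open>N\<close> for the squared norm of the \<open>T\<close>-component of the gradient at \<open>y k\<close>, and let \<open>g\<close> be the
  pairwise gap there, the difference of the gradient's values at the away vertex and at the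
  Frank-Wolfe vertex.

  Strong convexity splits orthogonally along \<open>T\<close> and its complement.  The \<open>T\<close>-part contributes at
  most \<open>N / (2\<mu>)\<close> to \<open>h\<close>, and the part in \<open>S\<close> is controlled by \<open>g\<close> through the facial
  distance \<open>\<psi>\<close>: from the \<open>S\<close>-component of \<open>y k\<close> towards any point of \<open>S\<close>, \<open>f\<close> descends at a rate of at most \<open>g / \<psi>\<close>
  (\<open>facial_distance_directional_width\<close>).  Hence \<open>2\<mu>\<psi>\<^sup>2 (h - N / (2\<mu>)) \<le> g\<^sup>2\<close>.

  The step in \<open>S\<close> moves along a direction of slope at most \<open>- g / 2\<close>, so by the definition of
  the curvature constant \<open>C\<close> an exact line search that may use every step size in \<open>[0, 1]\<close> gains at
  least \<open>\<rho> (h - N / (2\<mu>))\<close> with \<open>\<rho> = min (1/2) (\<sigma>/C)\<close> (\<open>line_search_decrease\<close>).  On the other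
  hand, the line search followed by the next gradient step along \<open>T\<close> gains at least \<open>\<eta> N / 4\<close>
  (\<open>two_phase_decrease\<close>): either the \<open>T\<close>-gradient survives the line search and the gradient step
  profits from it, or its change is paid for by cocoercivity.  The convex combination of both gains
  with weight \<open>\<mu>\<eta> / 4\<close> on the first eliminates \<open>N\<close> and yields the factor \<open>1 - \<rho>\<mu>\<eta> / 4\<close>.

  The only steps for which this gain may fail are away steps that stop at the maximal step size.  They do not
  increase \<open>f\<close>, and each removes an active vertex.  Since every other step adds at most one and the
  method starts with one, such steps make up at most half of any initial stretch, whence the exponent \<open>k/2\<close>.
\<close>


section \<open>Facial distance\<close>

text \<open>
  The intersection of all faces through \<open>u\<close> works: were \<open>u\<close> on its relative boundary, a supporting
  hyperplane at \<open>u\<close> would cut out a smaller face through \<open>u\<close>.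
\<close>
lemma point_in_rel_interior_of_face:
  fixes S :: "'a::euclidean_space set"
  assumes "convex S" "u \<in> S"
  obtains F where "F face_of S" "u \<in> rel_interior F"
proof -
  define F where "F = \<Inter>{F. F face_of S \<and> u \<in> F}"
  have F: "F face_of S"
    unfolding F_def
  proof (rule face_of_Inter)
    show "{F. F face_of S \<and> u \<in> F} \<noteq> {}" using face_of_refl[OF assms(1)] assms(2) by blast
  qed simp
  have u: "u \<in> F" by (auto simp: F_def)
  have cF: "convex F" using F face_of_imp_convex by blast
  have "u \<in> rel_interior F"
  proof (rule ccontr)
    assume "u \<notin> rel_interior F"
    from supporting_hyperplane_rel_boundary[OF cF u this]
    obtain a where a: "\<And>z. z \<in> F \<Longrightarrow> a \<bullet> u \<le> a \<bullet> z"
        "\<And>z. z \<in> rel_interior F \<Longrightarrow> a \<bullet> u < a \<bullet> z"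
      by metis
    have "F \<inter> {z. a \<bullet> z = a \<bullet> u} face_of F"
      using face_of_Int_supporting_hyperplane_ge[OF cF a(1)] by blast
    then have "F \<inter> {z. a \<bullet> z = a \<bullet> u} face_of S"
      using F face_of_trans by blast
    moreover have "u \<in> F \<inter> {z. a \<bullet> z = a \<bullet> u}" using u by simp
    ultimately have "F \<subseteq> F \<inter> {z. a \<bullet> z = a \<bullet> u}"
      unfolding F_def by (intro Inter_lower CollectI conjI)
    moreover obtain z where "z \<in> rel_interior F"
      using u cF rel_interior_eq_empty by blast
    moreover from this have "z \<in> F" using rel_interior_subset by (rule rev_subsetD)
    ultimately have "a \<bullet> z = a \<bullet> u" by blast
    then show False using a(2)[OF \<open>z \<in> rel_interior F\<close>] by simp
  qed
  then show ?thesis using that F by blast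
qed

lemma finite_face_distances:
  fixes S :: "'a::euclidean_space set"
  assumes "polyhedron S"
  shows "finite {setdist F (convex hull (vertices S - F)) | F. F face_of S \<and> F \<noteq> {} \<and> F \<noteq> S}"
proof -
  have "finite ((\<lambda>F. setdist F (convex hull (vertices S - F))) ` {F. F face_of S})"
    by (rule finite_imageI) (rule finite_polyhedron_faces[OF assms])
  then show ?thesis by (rule rev_finite_subset) blast
qed

lemma facial_distance_le_norm_diff:
  fixes S :: "'a::euclidean_space set"
  assumes "polyhedron S" "F face_of S" "F \<noteq> S" "u \<in> F" "p \<in> convex hull (vertices S - F)"
  shows "facial_distance S \<le> norm (p - u)"
proof -
  have "facial_distance S \<le> setdist F (convex hull (vertices S - F))"
    unfolding facial_distance_def
    by (rule Min_le[OF finite_face_distances[OF assms(1)]]) (use assms in blast)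
  also have "\<dots> \<le> dist u p" using assms(4,5) by (rule setdist_le_dist)
  finally show ?thesis by (simp add: dist_norm norm_minus_commute)
qed

lemma facial_distance_nonneg:
  fixes S :: "'a::euclidean_space set"
  assumes "polyhedron S" "bounded S" "\<not> is_singleton S" "S \<noteq> {}"
  shows "0 \<le> facial_distance S"
proof -
  have "compact S" "convex S"
    using assms polyhedron_imp_closed compact_eq_bounded_closed polyhedron_imp_convex by blast+
  then obtain v where "v extreme_point_of S"
    using extreme_point_exists_convex assms(4) by blast
  then have "{v} face_of S" by (simp add: face_of_singleton)
  moreover have "{v} \<noteq> S" using assms(3) by (auto intro: is_singletonI)
  ultimately have ne: "{setdist F (convex hull (vertices S - F)) | F. F face_of S \<and> F \<noteq> {} \<and> F \<noteq> S} \<noteq> {}"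
    by blast
  show ?thesis
    unfolding facial_distance_def Min_ge_iff[OF finite_face_distances[OF assms(1)] ne]
    using setdist_pos_le by blast
qed

text \<open>
  The facial distance turns the range of a linear form over the active vertices and \<open>S\<close> into a bound
  on its slope from \<open>p\<close> towards any point \<open>u\<close> of \<open>S\<close>.  Write \<open>p - u = t (p' - u')\<close> with \<open>p'\<close> in
  the hull of \<open>V\<close>, \<open>u'\<close> in \<open>S\<close> and \<open>t\<close> minimal.  If a vertex carrying weight in \<open>p'\<close> belonged to
  the smallest face \<open>F\<close> of \<open>u'\<close>, a bit of it could be removed from both points, which would shrink
  \<open>t\<close>.  So \<open>p'\<close> lies in the hull of the vertices outside \<open>F\<close>, and the distance from \<open>p'\<close> to \<open>u'\<close>
  is at least the facial distance.  The slope is the same along both differences.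
\<close>
lemma facial_distance_directional_width:
  fixes S :: "'a::euclidean_space set"
  assumes S: "polyhedron S" "bounded S" and V: "V \<subseteq> vertices S"
    and p: "p \<in> convex hull V" and u: "u \<in> S"
    and smin: "\<And>z. z \<in> S \<Longrightarrow> c \<bullet> s \<le> c \<bullet> z" and vmax: "\<And>z. z \<in> V \<Longrightarrow> c \<bullet> z \<le> c \<bullet> v"
  shows "facial_distance S * (c \<bullet> (p - u)) \<le> (c \<bullet> (v - s)) * norm (p - u)"
proof (cases "p = u")
  case True
  then show ?thesis by simp
next
  case False
  have cS: "compact S" "convex S"
    using S polyhedron_imp_closed compact_eq_bounded_closed polyhedron_imp_convex by blast+
  have finV: "finite V"
    using V finite_subset finite_polyhedron_extreme_points[OF S(1)] unfolding vertices_def by blast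
  have VS: "V \<subseteq> S" using V by (auto simp: vertices_def extreme_point_of_def)
  have hullS: "convex hull V \<subseteq> S" using VS cS hull_minimal by blast
  have le_v: "c \<bullet> z \<le> c \<bullet> v" if "z \<in> convex hull V" for z
  proof -
    have "convex hull V \<subseteq> {z. c \<bullet> z \<le> c \<bullet> v}"
      by (rule hull_minimal) (use vmax convex_halfspace_le in auto)
    then show ?thesis using that by blast
  qed
  \<comment> \<open>All ways to write \<open>p - u\<close> as \<open>t (p' - u')\<close>; compactness yields one with least \<open>t\<close>.\<close>
  define K where "K = ({0..1::real} \<times> ((convex hull V) \<times> S)) \<inter>
      {q. fst q *\<^sub>R (fst (snd q) - snd (snd q)) = p - u}"
  have "compact K"
    unfolding K_def
    by (intro compact_Int_closed compact_Times compact_convex_hull finite_imp_compact closed_Collect_eq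
        continuous_intros finV cS compact_Icc)
  moreover have "(1, p, u) \<in> K" using p u by (auto simp: K_def)
  ultimately obtain q where q: "q \<in> K" "\<And>q'. q' \<in> K \<Longrightarrow> fst q \<le> fst q'"
    using continuous_attains_inf[of K fst] continuous_on_fst[OF continuous_on_id] by blast
  obtain t p' u' where qeq: "q = (t, p', u')" by (cases q) auto
  have t: "0 \<le> t" "t \<le> 1" "p' \<in> convex hull V" "u' \<in> S" "t *\<^sub>R (p' - u') = p - u"
    using q(1) by (auto simp: K_def qeq)
  have tmin: "t \<le> t'" if "0 \<le> t'" "t' \<le> 1" "a \<in> convex hull V" "b \<in> S" "t' *\<^sub>R (a - b) = p - u" for t' a b
    using q(2)[of "(t', a, b)"] that by (auto simp: K_def qeq)
  have t0: "t > 0" using t False by (cases "t = 0") auto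
  obtain F where F: "F face_of S" "u' \<in> rel_interior F"
    using point_in_rel_interior_of_face[OF cS(2) t(4)] by blast
  have uF: "u' \<in> F" using F rel_interior_subset by blast
  have cF: "convex F" "F \<subseteq> S" using F face_of_imp_convex face_of_imp_subset by blast+
  obtain w where w: "\<And>z. z \<in> V \<Longrightarrow> 0 \<le> w z" "sum w V = 1" "(\<Sum>z\<in>V. w z *\<^sub>R z) = p'"
    using t(3) unfolding convex_hull_finite[OF finV] by auto
  have supp: "w z = 0" if z: "z \<in> V" "z \<in> F" for z
  proof (rule ccontr)
    assume "w z \<noteq> 0"
    then have lz: "w z > 0" using w(1)[OF z(1)] by simp
    obtain e where e: "e > 1" "(1 - e) *\<^sub>R z + e *\<^sub>R u' \<in> F"
      using convex_rel_interior_if2[OF cF(1) F(2)] z(2) hull_inc[of z F affine] by blast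
    have e1: "0 < 1 - 1 / e" "1 - 1 / e < 1" using e(1) by (simp_all add: field_simps)
    then obtain \<epsilon> where "0 < \<epsilon>" "\<epsilon> < min (w z) (1 - 1 / e)"
      using dense[of 0 "min (w z) (1 - 1 / e)"] lz by auto
    then have ep: "0 < \<epsilon>" "\<epsilon> < w z" "\<epsilon> < 1 - 1 / e" "\<epsilon> < 1"
      using e1 by linarith+
    \<comment> \<open>The points \<open>u'\<close> and \<open>p'\<close> with the share \<open>\<epsilon>\<close> of \<open>z\<close> removed and renormalised.\<close>
    define b where "b = (1 / (1 - \<epsilon>)) *\<^sub>R (u' - \<epsilon> *\<^sub>R z)"
    define a where "a = (1 / (1 - \<epsilon>)) *\<^sub>R (p' - \<epsilon> *\<^sub>R z)"
    have bS: "b \<in> S"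
    proof -
      \<comment> \<open>The point \<open>b\<close> lies on the segment from \<open>z\<close> to the point of \<open>F\<close> beyond \<open>u'\<close>.\<close>
      define k where "k = 1 / ((1 - \<epsilon>) * e)"
      have k: "0 \<le> k" "k \<le> 1" using ep e by (auto simp: k_def field_simps)
      have "(1 - k) *\<^sub>R z + k *\<^sub>R ((1 - e) *\<^sub>R z + e *\<^sub>R u') = (1 - k * e) *\<^sub>R z + (k * e) *\<^sub>R u'"
        by (simp add: algebra_simps)
      also have "\<dots> = b"
      proof -
        have ke: "k * e = 1 / (1 - \<epsilon>)" "1 - k * e = - (1 / (1 - \<epsilon>)) * \<epsilon>"
          using ep e by (simp_all add: k_def field_simps)
        show ?thesis unfolding ke(2) unfolding ke(1) by (simp add: b_def scaleR_diff_right)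
      qed
      finally have "b = (1 - k) *\<^sub>R z + k *\<^sub>R ((1 - e) *\<^sub>R z + e *\<^sub>R u')" by simp
      then show ?thesis using cS(2) k z(1) VS e(2) cF(2) unfolding convex_alt by auto
    qed
    have aV: "a \<in> convex hull V"
    proof -
      define m where "m = (\<lambda>x. (1 / (1 - \<epsilon>)) * (w x - (if x = z then \<epsilon> else 0)))"
      have "\<And>x. x \<in> V \<Longrightarrow> 0 \<le> m x" using w(1) ep by (auto simp: m_def)
      moreover have "sum m V = 1"
        using w(2) finV z(1) ep unfolding m_def sum_distrib_left[symmetric] sum_subtractf by simp
      moreover have "(\<Sum>x\<in>V. m x *\<^sub>R x) = a"
      proof -
        have "(\<Sum>x\<in>V. m x *\<^sub>R x) = (1 / (1 - \<epsilon>)) *\<^sub>R (\<Sum>x\<in>V. w x *\<^sub>R x - (if x = z then \<epsilon> *\<^sub>R z else 0))"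
          by (auto simp: m_def scaleR_sum_right algebra_simps intro!: sum.cong)
        then show ?thesis using finV z(1) w(3) by (simp add: a_def sum_subtractf)
      qed
      ultimately show ?thesis unfolding convex_hull_finite[OF finV] by blast
    qed
    have "a - b = (1 / (1 - \<epsilon>)) *\<^sub>R (p' - u')" by (simp add: a_def b_def algebra_simps)
    then have "(t * (1 - \<epsilon>)) *\<^sub>R (a - b) = p - u" using t(5) ep by simp
    then have "t \<le> t * (1 - \<epsilon>)"
      using tmin[of "t * (1 - \<epsilon>)" a b] aV bS t ep by (simp add: mult_le_one)
    then show False using mult_pos_pos[OF ep(1) t0] by (simp add: algebra_simps)
  qed
  have "p' \<in> convex hull (V - F)"
  proof -
    have "sum w (V - F) = 1" "(\<Sum>z\<in>V - F. w z *\<^sub>R z) = p'"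
      using w(2,3) sum.mono_neutral_left[OF finV, of "V - F" w]
        sum.mono_neutral_left[OF finV, of "V - F" "\<lambda>z. w z *\<^sub>R z"] supp by auto
    then show ?thesis
      using w(1) unfolding convex_hull_finite[OF finite_Diff[OF finV]] by blast
  qed
  moreover have "V - F \<subseteq> vertices S - F" using V by blast
  ultimately have "p' \<in> convex hull (vertices S - F)" using hull_mono by blast
  moreover from this have "F \<noteq> S"
  proof (rule contrapos_pn)
    assume "F = S"
    then have "vertices S - F = {}" by (auto simp: vertices_def extreme_point_of_def)
    then show "p' \<notin> convex hull (vertices S - F)" by (simp only: convex_hull_empty empty_iff simp_thms)
  qed
  ultimately have psi: "facial_distance S \<le> norm (p' - u')"
    by (intro facial_distance_le_norm_diff[OF S(1) F(1) _ uF])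
  have g: "c \<bullet> (p' - u') \<le> c \<bullet> (v - s)"
    using le_v[OF t(3)] smin[OF t(4)] by (simp add: inner_diff_right)
  have g0: "0 \<le> c \<bullet> (v - s)"
  proof -
    have "c \<bullet> s \<le> c \<bullet> p" using smin hullS p by blast
    then show ?thesis using le_v[OF p] by (simp add: inner_diff_right)
  qed
  have eqs: "norm (p - u) = t * norm (p' - u')" "c \<bullet> (p - u) = t * (c \<bullet> (p' - u'))"
    unfolding t(5)[symmetric] using t(1) by simp_all
  show ?thesis
  proof (cases "facial_distance S \<ge> 0")
    case True
    have "facial_distance S * (c \<bullet> (p' - u')) \<le> facial_distance S * (c \<bullet> (v - s))"
      using g True by (simp add: mult_left_mono)
    also have "\<dots> \<le> norm (p' - u') * (c \<bullet> (v - s))" using psi g0 by (simp add: mult_right_mono)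
    finally have "t * (facial_distance S * (c \<bullet> (p' - u'))) \<le> t * (norm (p' - u') * (c \<bullet> (v - s)))"
      using t0 by (intro mult_left_mono) auto
    moreover have "a * (t * b) \<le> e * (t * d)" if "t * (a * b) \<le> t * (d * e)" for a b d e :: real
      using that by (simp add: mult_ac)
    ultimately show ?thesis unfolding eqs by blast
  next
    case False
    \<comment> \<open>A negative value is excluded, as \<open>F\<close> witnesses that \<open>S\<close> has a proper nonempty face.\<close>
    have "u' \<in> F" "F \<noteq> S" by fact+
    then have "S \<noteq> {}" "\<And>z. S \<noteq> {z}" using cF(2) by blast+
    then have "S \<noteq> {}" "\<not> is_singleton S" unfolding is_singleton_def by blast+
    then show ?thesis using False facial_distance_nonneg[OF S] by simp
  qed
qed

section \<open>Gradients and convexity along lines\<close>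

lemma has_derivative_gradient:
  fixes f :: "'a::euclidean_space \<Rightarrow> real"
  assumes "f differentiable (at x)"
  shows "(f has_derivative (\<lambda>h. gradient f x \<bullet> h)) (at x)"
proof -
  obtain f' where f': "(f has_derivative f') (at x)" using assms by (auto simp: differentiable_def)
  then have "linear f'" using has_derivative_linear by blast
  then have "f' = (\<lambda>h. h \<bullet> adjoint f' 1)" by (simp add: adjoint_works)
  then have "GDERIV f x :> adjoint f' 1" using f' by (simp add: gderiv_def)
  from gradient_eqI[OF this] this show ?thesis by (simp add: gderiv_def inner_commute)
qed

lemma DERIV_along_line:
  fixes f :: "'a::euclidean_space \<Rightarrow> real"
  assumes "f differentiable (at (a + t *\<^sub>R d))"
  shows "((\<lambda>t. f (a + t *\<^sub>R d)) has_real_derivative gradient f (a + t *\<^sub>R d) \<bullet> d) (at t)"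
proof -
  have "((\<lambda>t. a + t *\<^sub>R d) has_derivative (\<lambda>t. t *\<^sub>R d)) (at t)"
    by (auto intro!: derivative_eq_intros)
  from has_derivative_compose[OF this has_derivative_gradient[OF assms]]
  show ?thesis
    unfolding has_field_derivative_def
    by (rule has_derivative_eq_rhs) (auto simp: fun_eq_iff)
qed

lemma descent_lemma:
  fixes f :: "'a::euclidean_space \<Rightarrow> real"
  assumes diff: "\<And>z. f differentiable (at z)"
    and lip: "\<And>t. 0 \<le> t \<Longrightarrow> t \<le> 1 \<Longrightarrow> norm (gradient f (u + t *\<^sub>R e) - gradient f u) \<le> L * norm (t *\<^sub>R e)"
  shows "f (u + e) \<le> f u + gradient f u \<bullet> e + L / 2 * (norm e)\<^sup>2"
proof -
  define \<phi> where "\<phi> = (\<lambda>t. f (u + t *\<^sub>R e) - t * (gradient f u \<bullet> e) - L / 2 * t\<^sup>2 * (norm e)\<^sup>2)"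
  have "\<phi> 0 \<ge> \<phi> 1"
  proof (rule DERIV_nonpos_imp_nonincreasing[of 0 1 \<phi>])
    fix t :: real assume t: "0 \<le> t" "t \<le> 1"
    have "(\<phi> has_real_derivative
        (gradient f (u + t *\<^sub>R e) \<bullet> e - gradient f u \<bullet> e - L * t * (norm e)\<^sup>2)) (at t)"
      unfolding \<phi>_def by (auto intro!: derivative_eq_intros DERIV_along_line diff)
    moreover have "gradient f (u + t *\<^sub>R e) \<bullet> e - gradient f u \<bullet> e \<le> L * t * (norm e)\<^sup>2"
    proof -
      have "gradient f (u + t *\<^sub>R e) \<bullet> e - gradient f u \<bullet> e = (gradient f (u + t *\<^sub>R e) - gradient f u) \<bullet> e"
        by (simp add: inner_diff_left)
      also have "\<dots> \<le> norm (gradient f (u + t *\<^sub>R e) - gradient f u) * norm e"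
        by (rule norm_cauchy_schwarz)
      also have "\<dots> \<le> L * norm (t *\<^sub>R e) * norm e"
        using lip[OF t] by (simp add: mult_right_mono)
      finally show ?thesis using t by (simp add: power2_eq_square mult.assoc)
    qed
    ultimately show "\<exists>D. DERIV \<phi> t :> D \<and> D \<le> 0" by force
  qed simp
  then show ?thesis by (simp add: \<phi>_def)
qed

lemma convex_on_line:
  fixes f :: "'a::real_vector \<Rightarrow> real"
  assumes "convex_on UNIV f"
  shows "convex_on UNIV (\<lambda>t::real. f (a + t *\<^sub>R d))"
proof (rule convex_onI)
  fix t x y :: real assume t: "0 < t" "t < 1"
  have "a + ((1 - t) *\<^sub>R x + t *\<^sub>R y) *\<^sub>R d = (1 - t) *\<^sub>R (a + x *\<^sub>R d) + t *\<^sub>R (a + y *\<^sub>R d)"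
    by (simp add: algebra_simps)
  then show "f (a + ((1 - t) *\<^sub>R x + t *\<^sub>R y) *\<^sub>R d) \<le> (1 - t) * f (a + x *\<^sub>R d) + t * f (a + y *\<^sub>R d)"
    using convex_onD[OF assms, of t "a + x *\<^sub>R d" "a + y *\<^sub>R d"] t by simp
qed simp

lemma convex_above_gradient:
  fixes f :: "'a::euclidean_space \<Rightarrow> real"
  assumes "convex_on UNIV f" "f differentiable (at a)"
  shows "f a + gradient f a \<bullet> (b - a) \<le> f b"
proof -
  have "((\<lambda>t. f (a + t *\<^sub>R (b - a))) has_real_derivative gradient f a \<bullet> (b - a)) (at 0 within UNIV)"
    using DERIV_along_line[of f a 0 "b - a"] assms(2) by simp
  from convex_on_imp_above_tangent[OF convex_on_line[OF assms(1)] _ _ _ this, of 1]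
  show ?thesis by simp
qed

lemma gradient_nonneg_towards_segment_end:
  fixes f :: "'a::euclidean_space \<Rightarrow> real"
  assumes diff: "f differentiable (at a)"
    and min: "\<And>t. 0 \<le> t \<Longrightarrow> t \<le> 1 \<Longrightarrow> f a \<le> f (a + t *\<^sub>R d)"
  shows "0 \<le> gradient f a \<bullet> d"
proof (rule ccontr)
  assume "\<not> ?thesis"
  then have neg: "gradient f a \<bullet> d < 0" by simp
  have "((\<lambda>t. f (a + t *\<^sub>R d)) has_real_derivative gradient f a \<bullet> d) (at 0)"
    using DERIV_along_line[of f a 0 d] diff by simp
  from DERIV_neg_dec_right[OF this neg]
  obtain e where e: "e > 0" "\<forall>h>0. h < e \<longrightarrow> f (a + 0 *\<^sub>R d) > f (a + (0 + h) *\<^sub>R d)"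
    by blast
  have "f a > f (a + min 1 (e / 2) *\<^sub>R d)" using e by (auto simp: min_def)
  then show False using min[of "min 1 (e / 2)"] e(1) by simp
qed

text \<open>
  An away step that stops short of its maximal step size has found the minimum along the whole ray,
  so it may be compared with a step of any size in \<open>[0, 1]\<close>, even when that size is not admissible.
\<close>
lemma convex_interior_minimum_extends:
  fixes \<phi> :: "real \<Rightarrow> real"
  assumes "convex_on UNIV \<phi>" "\<And>t. 0 \<le> t \<Longrightarrow> t \<le> m \<Longrightarrow> \<phi> \<alpha> \<le> \<phi> t" "0 \<le> \<alpha>" "\<alpha> < m" "0 \<le> t"
  shows "\<phi> \<alpha> \<le> \<phi> t"
proof (cases "t \<le> m")
  case True
  then show ?thesis using assms by blast
next
  case False
  define k where "k = (m - \<alpha>) / (t - \<alpha>)"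
  have k: "0 < k" "k < 1" using assms False by (auto simp: k_def field_simps)
  have "k * (t - \<alpha>) = m - \<alpha>" using assms False by (simp add: k_def)
  then have "(1 - k) *\<^sub>R \<alpha> + k *\<^sub>R t = m" by (simp add: algebra_simps)
  then have "\<phi> m \<le> (1 - k) * \<phi> \<alpha> + k * \<phi> t" using convex_onD[OF assms(1), of k \<alpha> t] k by simp
  moreover have "\<phi> \<alpha> \<le> \<phi> m" using assms(2)[of m] assms(3,4) by simp
  ultimately have "k * \<phi> \<alpha> \<le> k * \<phi> t" by (simp add: algebra_simps)
  then show ?thesis using k by simp
qed

section \<open>Orthogonal projections\<close>

lemma orth_proj_add:
  assumes "subspace T" "t \<in> T" "s \<in> T\<^sup>\<bottom>"
  shows "orth_proj T (t + s) = t"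
  unfolding orth_proj_def
proof (rule the_equality)
  show "t \<in> T \<and> t + s - t \<in> T\<^sup>\<bottom>" using assms by simp
  fix p assume p: "p \<in> T \<and> t + s - p \<in> T\<^sup>\<bottom>"
  then have "(t + s - p) - s \<in> T\<^sup>\<bottom>" using assms subspace_diff[OF subspace_orthogonal_comp] by blast
  then have "t - p \<in> T\<^sup>\<bottom>" by simp
  moreover have "t - p \<in> T" using p assms subspace_diff by blast
  ultimately have "(t - p) \<bullet> (t - p) = 0" by (auto simp: orthogonal_comp_def orthogonal_def)
  then show "p = t" by simp
qed

lemma orth_proj_comp_add:
  fixes T :: "'a::euclidean_space set"
  assumes "subspace T" "t \<in> T" "s \<in> T\<^sup>\<bottom>"
  shows "orth_proj (T\<^sup>\<bottom>) (t + s) = s"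
  using orth_proj_add[of "T\<^sup>\<bottom>" s t] assms orthogonal_comp_self[of T] subspace_orthogonal_comp[of T]
  by (simp add: add.commute)

lemma orth_decomp:
  fixes T :: "'a::euclidean_space set"
  assumes "subspace T"
  shows "orth_proj T x \<in> T" "orth_proj (T\<^sup>\<bottom>) x \<in> T\<^sup>\<bottom>" "orth_proj T x + orth_proj (T\<^sup>\<bottom>) x = x"
proof -
  have "x \<in> T + T\<^sup>\<bottom>" using subspace_sum_orthogonal_comp[OF assms] by simp
  then obtain t s where "t \<in> T" "s \<in> T\<^sup>\<bottom>" "x = t + s" by (auto elim: set_plus_elim)
  then show "orth_proj T x \<in> T" "orth_proj (T\<^sup>\<bottom>) x \<in> T\<^sup>\<bottom>" "orth_proj T x + orth_proj (T\<^sup>\<bottom>) x = x"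
    using orth_proj_add[OF assms] orth_proj_comp_add[OF assms] by auto
qed

lemma inner_orth_comp: "t \<in> T \<Longrightarrow> s \<in> T\<^sup>\<bottom> \<Longrightarrow> t \<bullet> s = 0"
  by (auto simp: orthogonal_comp_def orthogonal_def)

lemma orth_proj_inner:
  fixes T :: "'a::euclidean_space set"
  assumes "subspace T" "t \<in> T"
  shows "orth_proj T x \<bullet> t = x \<bullet> t"
  using orth_decomp[OF assms(1), of x] inner_orth_comp[OF assms(2), of "orth_proj (T\<^sup>\<bottom>) x"]
  by (metis add.right_neutral inner_add_right inner_commute)

section \<open>Weights on the active vertices\<close>

text \<open>
  Zero weights are admitted because a Frank-Wolfe update of length 0 activates its vertex with
  weight 0.
\<close>
definition active_rep ::
  "'a::real_vector set \<Rightarrow> 'a set \<Rightarrow> ('a \<Rightarrow> real) \<Rightarrow> 'a \<Rightarrow> bool" where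
  "active_rep S V w p \<longleftrightarrow> finite V \<and> V \<subseteq> vertices S \<and> (\<forall>v\<in>V. 0 \<le> w v) \<and> sum w V = 1 \<and>
     (\<Sum>v\<in>V. w v *\<^sub>R v) = p"

lemma active_rep_convex_hull:
  assumes "active_rep S V w p"
  shows "p \<in> convex hull V"
  using assms unfolding active_rep_def by (auto simp: convex_hull_finite)

lemma active_rep_in:
  assumes "active_rep S V w p" "convex S"
  shows "p \<in> S"
proof -
  have "V \<subseteq> S" using assms by (auto simp: active_rep_def vertices_def extreme_point_of_def)
  then show ?thesis using active_rep_convex_hull[OF assms(1)] assms(2) hull_minimal by blast
qed

lemma active_rep_frank_wolfe:
  assumes rep: "active_rep S V w p" and s: "s \<in> vertices S" and \<alpha>: "0 \<le> \<alpha>" "\<alpha> \<le> 1"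
    and V': "V' = (if \<alpha> = 1 then {s} else V \<union> {s})"
    and ws: "w' s = (1 - \<alpha>) * (if s \<in> V then w s else 0) + \<alpha>"
    and wu: "\<forall>u \<in> V - {s}. w' u = (1 - \<alpha>) * w u"
  shows "active_rep S V' w' (p + \<alpha> *\<^sub>R (s - p))"
proof (cases "\<alpha> = 1")
  case True
  then show ?thesis using V' ws s by (simp add: active_rep_def)
next
  case False
  have V: "finite V" "V \<subseteq> vertices S" "\<And>v. v \<in> V \<Longrightarrow> 0 \<le> w v" "sum w V = 1" "(\<Sum>v\<in>V. w v *\<^sub>R v) = p"
    using rep by (auto simp: active_rep_def)
  have V'eq: "V' = insert s (V - {s})" using False V' by auto
  define w0 where "w0 = (if s \<in> V then w s else 0)"
  have "sum w V = w0 + sum w (V - {s})"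
    using V(1) by (cases "s \<in> V") (simp_all add: w0_def sum.remove[of V s])
  then have rest: "sum w (V - {s}) = 1 - w0" using V(4) by simp
  have "sum w' (V - {s}) = (1 - \<alpha>) * sum w (V - {s})"
    unfolding sum_distrib_left by (rule sum.cong) (use wu in auto)
  moreover have "sum w' V' = w' s + sum w' (V - {s})" using V(1) unfolding V'eq by (intro sum.insert) auto
  ultimately have "sum w' V' = 1"
    unfolding rest ws w0_def[symmetric] by (simp add: algebra_simps)
  moreover have "(\<Sum>v\<in>V'. w' v *\<^sub>R v) = p + \<alpha> *\<^sub>R (s - p)"
  proof -
    have ep: "p = w0 *\<^sub>R s + (\<Sum>v\<in>V - {s}. w v *\<^sub>R v)"
      using V(1,5) by (cases "s \<in> V") (auto simp: w0_def sum.remove[of V s "\<lambda>v. w v *\<^sub>R v"])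
    have er: "(\<Sum>v\<in>V - {s}. w' v *\<^sub>R v) = (1 - \<alpha>) *\<^sub>R (\<Sum>v\<in>V - {s}. w v *\<^sub>R v)"
      unfolding scaleR_sum_right by (rule sum.cong) (use wu in auto)
    have ev: "(\<Sum>v\<in>V'. w' v *\<^sub>R v) = w' s *\<^sub>R s + (\<Sum>v\<in>V - {s}. w' v *\<^sub>R v)"
      using V(1) unfolding V'eq by (intro sum.insert) auto
    show ?thesis unfolding ev er ws w0_def[symmetric] ep by (simp add: algebra_simps)
  qed
  moreover have "0 \<le> w' v" if "v \<in> V'" for v
  proof (cases "v = s")
    case True
    have "0 \<le> w0" using V(3) by (simp add: w0_def)
    then show ?thesis using True \<alpha> by (simp add: ws w0_def[symmetric])
  next
    case False
    then have "v \<in> V - {s}" using that by (simp add: V'eq)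
    then show ?thesis using wu V(3) \<alpha> by simp
  qed
  moreover have "finite V'" "V' \<subseteq> vertices S" using V s by (auto simp: V'eq)
  ultimately show ?thesis by (simp add: active_rep_def)
qed

text \<open>
  The bound on \<open>\<alpha>\<close> is the maximal step size multiplied by \<open>1 - w v\<close>.  In this form it also covers
  weight 1, where the maximal step size is infinite.
\<close>
lemma active_rep_away:
  assumes rep: "active_rep S V w p" and v: "v \<in> V" and \<alpha>: "0 \<le> \<alpha>" "\<alpha> * (1 - w v) \<le> w v"
    and V': "V' = V \<or> (V' = V - {v} \<and> \<alpha> * (1 - w v) = w v)"
    and wv: "w' v = (1 + \<alpha>) * w v - \<alpha>"
    and wu: "\<forall>u \<in> V - {v}. w' u = (1 + \<alpha>) * w u"
  shows "active_rep S V' w' (p + \<alpha> *\<^sub>R (p - v))"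
proof -
  have V: "finite V" "V \<subseteq> vertices S" "\<And>v. v \<in> V \<Longrightarrow> 0 \<le> w v" "sum w V = 1" "(\<Sum>v\<in>V. w v *\<^sub>R v) = p"
    using rep by (auto simp: active_rep_def)
  have wv0: "w' v \<ge> 0" "V' \<noteq> V \<Longrightarrow> w' v = 0" using \<alpha> V' wv by (auto simp: algebra_simps)
  have rest: "sum w (V - {v}) = 1 - w v" using V(4) sum.remove[OF V(1) v, of w] by simp
  have "sum w' (V - {v}) = (1 + \<alpha>) * sum w (V - {v})"
    unfolding sum_distrib_left by (rule sum.cong) (use wu in auto)
  then have "sum w' V = 1"
    unfolding rest sum.remove[OF V(1) v, of w'] wv by (simp add: algebra_simps)
  moreover have "(\<Sum>u\<in>V. w' u *\<^sub>R u) = p + \<alpha> *\<^sub>R (p - v)"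
  proof -
    have "p = w v *\<^sub>R v + (\<Sum>v\<in>V - {v}. w v *\<^sub>R v)"
      using V(5) sum.remove[OF V(1) v, of "\<lambda>v. w v *\<^sub>R v"] by simp
    moreover have "(\<Sum>v\<in>V - {v}. w' v *\<^sub>R v) = (1 + \<alpha>) *\<^sub>R (\<Sum>v\<in>V - {v}. w v *\<^sub>R v)"
      unfolding scaleR_sum_right by (rule sum.cong) (use wu in auto)
    ultimately show ?thesis
      using sum.remove[OF V(1) v, of "\<lambda>v. w' v *\<^sub>R v"] unfolding wv by (simp add: algebra_simps)
  qed
  moreover have "\<forall>u\<in>V. 0 \<le> w' u"
  proof
    fix u assume "u \<in> V"
    then show "0 \<le> w' u" using V(3)[of u] wu wv0(1) \<alpha>(1) by (cases "u = v") simp_all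
  qed
  ultimately have rep': "active_rep S V w' (p + \<alpha> *\<^sub>R (p - v))" using V by (simp add: active_rep_def)
  show ?thesis
  proof (cases "V' = V")
    case True
    then show ?thesis using rep' by simp
  next
    case False
    then have V'eq: "V' = V - {v}" and zero: "w' v = 0" using V' wv0(2) by blast+
    have "sum w' V' = sum w' V" "(\<Sum>u\<in>V'. w' u *\<^sub>R u) = (\<Sum>u\<in>V. w' u *\<^sub>R u)"
      using zero sum.remove[OF V(1) v, of w'] sum.remove[OF V(1) v, of "\<lambda>v. w' v *\<^sub>R v"]
      by (simp_all add: V'eq)
    then show ?thesis using rep' unfolding active_rep_def V'eq by auto
  qed
qed

section \<open>Bounds on the optimality gap and on the curvature\<close>

locale polytope_plus_subspace =
  fixes T S :: "'a::euclidean_space set" and f :: "'a \<Rightarrow> real" and L \<mu> \<eta> :: real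
  assumes T: "subspace T" and S_orth: "S \<subseteq> T\<^sup>\<bottom>" and S_convex: "convex S"
    and S_bounded: "bounded S" and S_polyhedron: "polyhedron S" and S_nonempty: "S \<noteq> {}"
    and f_convex: "convex_on UNIV f" and f_diff: "\<And>z. f differentiable (at z)"
    and smooth: "smooth_over L ({a + (b - c) | a b c. a \<in> S \<and> b \<in> S \<and> c \<in> S} + T) f"
    and \<mu>_pos: "\<mu> > 0" and strong: "strongly_convex_on \<mu> (S + T) f"
    and \<eta>_pos: "\<eta> > 0" and \<eta>_le: "\<eta> \<le> 1 / L"
begin

abbreviation "grad \<equiv> gradient f"
abbreviation "PT \<equiv> orth_proj T"
abbreviation "PS \<equiv> orth_proj (T\<^sup>\<bottom>)"
abbreviation "Q \<equiv> {a + (b - c) | a b c. a \<in> S \<and> b \<in> S \<and> c \<in> S} + T"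

lemma L_pos: "L > 0" and \<eta>L: "\<eta> * L \<le> 1"
proof -
  show "L > 0" using \<eta>_pos \<eta>_le by (metis less_le_trans zero_less_divide_1_iff)
  then show "\<eta> * L \<le> 1" using \<eta>_le by (simp add: field_simps)
qed

lemma in_S_plus_T_iff: "x \<in> S + T \<longleftrightarrow> PS x \<in> S"
proof
  assume "x \<in> S + T"
  then obtain s t where "s \<in> S" "t \<in> T" "x = s + t" by (auto elim: set_plus_elim)
  then show "PS x \<in> S" using orth_proj_comp_add[OF T, of t s] S_orth by (auto simp: add.commute)
next
  assume "PS x \<in> S"
  then have "PS x + PT x \<in> S + T" using orth_decomp[OF T] by (simp add: set_plus_intro)
  then show "x \<in> S + T" using orth_decomp(3)[OF T, of x] by (simp add: add.commute)
qed

lemma PS_add_T: "t \<in> T \<Longrightarrow> PS (x + t) = PS x"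
  using orth_proj_comp_add[OF T, of "PT x + t" "PS x"] orth_decomp[OF T, of x] subspace_add[OF T]
  by (metis (no_types, opaque_lifting) add.assoc add.commute)

lemma PS_add_comp: "e \<in> T\<^sup>\<bottom> \<Longrightarrow> PS (x + e) = PS x + e"
  using orth_proj_comp_add[OF T, of "PT x" "PS x + e"] orth_decomp[OF T, of x]
    subspace_add[OF subspace_orthogonal_comp]
  by (metis (no_types, opaque_lifting) add.assoc)

lemma S_plus_T_subset_Q: "x \<in> S + T \<Longrightarrow> x \<in> Q"
proof -
  assume "x \<in> S + T"
  then obtain s t where "s \<in> S" "t \<in> T" "x = s + t" by (auto elim: set_plus_elim)
  moreover from this have "s \<in> {a + (b - c) | a b c. a \<in> S \<and> b \<in> S \<and> c \<in> S}"
    by (auto intro!: exI[of _ s])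
  ultimately show "x \<in> Q" by (auto intro: set_plus_intro)
qed

lemma in_QI: "a \<in> S \<Longrightarrow> b \<in> S \<Longrightarrow> c \<in> S \<Longrightarrow> t \<in> T \<Longrightarrow> a + (b - c) + t \<in> Q"
  by (auto intro!: set_plus_intro)

lemma gradient_lipschitz: "u \<in> Q \<Longrightarrow> v \<in> Q \<Longrightarrow> norm (grad u - grad v) \<le> L * norm (u - v)"
  using smooth by (auto simp: smooth_over_def)

lemma descent_along_T:
  assumes "x \<in> S + T" "e \<in> T"
  shows "f (x + e) \<le> f x + grad x \<bullet> e + L / 2 * (norm e)\<^sup>2"
proof (rule descent_lemma)
  fix t :: real
  have "t *\<^sub>R e \<in> T" using assms T by (simp add: subspace_scale)
  then have "x + t *\<^sub>R e \<in> S + T" using assms in_S_plus_T_iff PS_add_T by simp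
  then show "norm (grad (x + t *\<^sub>R e) - grad x) \<le> L * norm (t *\<^sub>R e)"
    using gradient_lipschitz[of "x + t *\<^sub>R e" x] assms S_plus_T_subset_Q by simp
qed (rule f_diff)

lemma gradient_step_decrease:
  assumes "x \<in> S + T"
  shows "f (x - \<eta> *\<^sub>R PT (grad x)) \<le> f x - \<eta> / 2 * (norm (PT (grad x)))\<^sup>2"
proof -
  let ?g = "PT (grad x)"
  have g: "?g \<in> T" using orth_decomp[OF T] by blast
  have ng: "grad x \<bullet> ?g = (norm ?g)\<^sup>2"
    using orth_proj_inner[OF T g, of "grad x"] by (simp add: power2_norm_eq_inner)
  have "f (x + (- \<eta>) *\<^sub>R ?g) \<le> f x + grad x \<bullet> ((- \<eta>) *\<^sub>R ?g) + L / 2 * (norm ((- \<eta>) *\<^sub>R ?g))\<^sup>2"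
    by (rule descent_along_T) (use assms g subspace_scale[OF T g] subspace_neg[OF T] in auto)
  also have "\<dots> = f x - \<eta> * (norm ?g)\<^sup>2 + (\<eta> * L) * (\<eta> / 2 * (norm ?g)\<^sup>2)"
    by (simp add: ng power_mult_distrib power2_eq_square[of \<eta>])
  also have "(\<eta> * L) * (\<eta> / 2 * (norm ?g)\<^sup>2) \<le> 1 * (\<eta> / 2 * (norm ?g)\<^sup>2)"
    by (rule mult_right_mono) (use \<eta>L \<eta>_pos in auto)
  finally show ?thesis by simp
qed

text \<open>
  Cocoercivity restricted to the \<open>T\<close>-component of the gradient.  From \<open>y\<close>, a gradient step along \<open>T\<close> for
  the convex function \<open>\<lambda>z. f z - grad x \<bullet> z\<close>, which \<open>x\<close> minimises globally, cannot get below its value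
  at \<open>x\<close>.
  Such a step stays inside \<open>S + T\<close>, where smoothness is available.
\<close>
lemma partial_cocoercivity:
  assumes "y \<in> S + T"
  shows "\<eta> / 2 * (norm (PT (grad y - grad x)))\<^sup>2 \<le> f y - f x - grad x \<bullet> (y - x)"
proof -
  let ?b = "PT (grad y - grad x)"
  have b: "?b \<in> T" using orth_decomp[OF T] by blast
  have "f x + grad x \<bullet> (y + (- \<eta>) *\<^sub>R ?b - x) \<le> f (y + (- \<eta>) *\<^sub>R ?b)"
    by (rule convex_above_gradient[OF f_convex f_diff])
  also have "\<dots> \<le> f y + grad y \<bullet> ((- \<eta>) *\<^sub>R ?b) + L / 2 * (norm ((- \<eta>) *\<^sub>R ?b))\<^sup>2"
    by (rule descent_along_T) (use assms b subspace_scale[OF T b] subspace_neg[OF T] in auto)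
  also have "L / 2 * (norm ((- \<eta>) *\<^sub>R ?b))\<^sup>2 = (\<eta> * L) * (\<eta> / 2 * (norm ?b)\<^sup>2)"
    by (simp add: power_mult_distrib power2_eq_square)
  also have "\<dots> \<le> 1 * (\<eta> / 2 * (norm ?b)\<^sup>2)"
    by (rule mult_right_mono) (use \<eta>L \<eta>_pos in auto)
  finally have "\<eta> * (grad y \<bullet> ?b) - \<eta> * (grad x \<bullet> ?b) - \<eta> / 2 * (norm ?b)\<^sup>2 \<le> f y - f x - grad x \<bullet> (y - x)"
    by (simp add: inner_diff_right inner_add_right)
  moreover have "grad y \<bullet> ?b - grad x \<bullet> ?b = (norm ?b)\<^sup>2"
    using orth_proj_inner[OF T b, of "grad y - grad x"] by (simp add: power2_norm_eq_inner inner_diff_left)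
  then have "\<eta> * (grad y \<bullet> ?b) - \<eta> * (grad x \<bullet> ?b) = \<eta> * (norm ?b)\<^sup>2"
    by (metis right_diff_distrib)
  ultimately show ?thesis by simp
qed

lemma PT_diff: "PT (a - b) = PT a - PT b"
proof -
  have "a - b = (PT a - PT b) + (PS a - PS b)"
    using orth_decomp(3)[OF T, of a] orth_decomp(3)[OF T, of b] by (simp add: algebra_simps)
  then show ?thesis
    using orth_proj_add[OF T, of "PT a - PT b" "PS a - PS b"] orth_decomp[OF T]
      subspace_diff[OF T] subspace_diff[OF subspace_orthogonal_comp] by metis
qed

text \<open>
  If \<open>f\<close> is minimal at \<open>x'\<close> on the segment from \<open>x'\<close> to \<open>y\<close>, passing from \<open>y\<close> to \<open>x'\<close> gains in
  proportion to the squared change of the \<open>T\<close>-gradient, and the gradient step at \<open>x'\<close> in proportion to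
  the squared \<open>T\<close>-gradient at \<open>x'\<close>.  One of these is at least half of the \<open>T\<close>-gradient at \<open>y\<close> in norm.
\<close>
lemma two_phase_decrease:
  assumes y: "y \<in> S + T" and x': "x' \<in> S + T"
    and first_order: "0 \<le> grad x' \<bullet> (y - x')"
  shows "\<eta> / 4 * (norm (PT (grad y)))\<^sup>2 \<le> f y - f (x' - \<eta> *\<^sub>R PT (grad x'))"
proof -
  let ?a = "PT (grad y)" and ?b = "PT (grad x')"
  have "(norm ?a)\<^sup>2 \<le> (norm (?a - ?b) + norm ?b)\<^sup>2"
    using norm_triangle_ineq[of "?a - ?b" ?b] by (intro power_mono) auto
  also have "\<dots> \<le> 2 * (norm (?a - ?b))\<^sup>2 + 2 * (norm ?b)\<^sup>2"
    using zero_le_power2[of "norm (?a - ?b) - norm ?b"] by (simp add: power2_eq_square algebra_simps)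
  finally have "\<eta> / 4 * (norm ?a)\<^sup>2 \<le> \<eta> / 4 * (2 * (norm (?a - ?b))\<^sup>2 + 2 * (norm ?b)\<^sup>2)"
    using \<eta>_pos by (intro mult_left_mono) auto
  also have "\<dots> = \<eta> / 2 * (norm (?a - ?b))\<^sup>2 + \<eta> / 2 * (norm ?b)\<^sup>2" by (simp add: algebra_simps)
  finally show ?thesis
    using partial_cocoercivity[OF y, of x'] gradient_step_decrease[OF x'] first_order
    by (simp add: PT_diff)
qed

text \<open>
  Strong convexity at \<open>y\<close>, split orthogonally.  In the \<open>T\<close>-component the quadratic term is used up by
  Young's inequality; in the complement it is kept.
\<close>
lemma gap_bound:
  assumes y: "y \<in> S + T" and z: "z \<in> S + T"
  shows "f y - f z - (norm (PT (grad y)))\<^sup>2 / (2 * \<mu>)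
    \<le> grad y \<bullet> (PS y - PS z) - \<mu> / 2 * (norm (PS y - PS z))\<^sup>2"
proof -
  define a where "a = PT y - PT z"
  define b where "b = PS y - PS z"
  have aT: "a \<in> T" and bT: "b \<in> T\<^sup>\<bottom>"
    unfolding a_def b_def by (intro subspace_diff T subspace_orthogonal_comp orth_decomp)+
  have yz: "y - z = a + b"
    using orth_decomp(3)[OF T, of y] orth_decomp(3)[OF T, of z] by (simp add: a_def b_def algebra_simps)
  have "\<mu> / 2 * (norm (z - y))\<^sup>2 \<le> f z - f y - grad y \<bullet> (z - y)"
    using strong y z by (auto simp: strongly_convex_on_def)
  moreover have "grad y \<bullet> (z - y) = - (grad y \<bullet> a) - grad y \<bullet> b"
    using yz by (metis inner_add_right inner_minus_right minus_diff_eq minus_add_distrib diff_conv_add_uminus)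
  moreover have "(norm (z - y))\<^sup>2 = (norm a)\<^sup>2 + (norm b)\<^sup>2"
    using yz inner_orth_comp[OF aT bT]
    by (simp add: norm_minus_commute power2_norm_eq_inner inner_add_left inner_add_right inner_commute)
  ultimately have "f y - f z \<le> (grad y \<bullet> a - \<mu> / 2 * (norm a)\<^sup>2) + (grad y \<bullet> b - \<mu> / 2 * (norm b)\<^sup>2)"
    by (simp add: algebra_simps)
  moreover have "grad y \<bullet> a - \<mu> / 2 * (norm a)\<^sup>2 \<le> (norm (PT (grad y)))\<^sup>2 / (2 * \<mu>)"
  proof -
    let ?g = "norm (PT (grad y))"
    have "grad y \<bullet> a \<le> ?g * norm a"
      using orth_proj_inner[OF T aT, of "grad y"] norm_cauchy_schwarz[of "PT (grad y)" a] by simp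
    moreover have "2 * \<mu> * (?g * norm a - \<mu> / 2 * (norm a)\<^sup>2) \<le> ?g\<^sup>2"
      using zero_le_power2[of "?g - \<mu> * norm a"] by (simp add: power2_eq_square algebra_simps)
    then have "?g * norm a - \<mu> / 2 * (norm a)\<^sup>2 \<le> ?g\<^sup>2 / (2 * \<mu>)"
      using \<mu>_pos by (simp add: field_simps)
    ultimately show ?thesis by linarith
  qed
  ultimately show ?thesis by (simp add: b_def)
qed

text \<open>
  Young's inequality in the complement of \<open>T\<close>, after the slope has been bounded by the facial distance.
  Multiplying by the squared facial distance avoids any division by it.
\<close>
lemma gap_bound_width:
  assumes y: "y \<in> S + T" and z: "z \<in> S + T"
    and V: "V \<subseteq> vertices S" "PS y \<in> convex hull V"
    and smin: "\<And>z. z \<in> S \<Longrightarrow> grad y \<bullet> s \<le> grad y \<bullet> z" and vmax: "\<And>z. z \<in> V \<Longrightarrow> grad y \<bullet> z \<le> grad y \<bullet> v"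
  shows "2 * \<mu> * (facial_distance S)\<^sup>2 * (f y - f z - (norm (PT (grad y)))\<^sup>2 / (2 * \<mu>))
    \<le> (grad y \<bullet> (v - s))\<^sup>2"
proof (cases "is_singleton S")
  case True
  have "PS z \<in> S" "PS y \<in> S" using y z in_S_plus_T_iff by auto
  then have "PS y = PS z" using True by (auto elim!: is_singletonE)
  then have "f y - f z - (norm (PT (grad y)))\<^sup>2 / (2 * \<mu>) \<le> 0" using gap_bound[OF y z] by simp
  then have "2 * \<mu> * (facial_distance S)\<^sup>2 * (f y - f z - (norm (PT (grad y)))\<^sup>2 / (2 * \<mu>)) \<le> 0"
    using \<mu>_pos by (intro mult_nonneg_nonpos) auto
  also have "0 \<le> (grad y \<bullet> (v - s))\<^sup>2" by simp
  finally show ?thesis .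
next
  case False
  let ?\<psi> = "facial_distance S" and ?r = "norm (PS y - PS z)" and ?g = "grad y \<bullet> (v - s)"
  have \<psi>: "?\<psi> \<ge> 0" using facial_distance_nonneg[OF S_polyhedron S_bounded False S_nonempty] .
  have w: "?\<psi> * (grad y \<bullet> (PS y - PS z)) \<le> ?g * ?r"
    by (rule facial_distance_directional_width[OF S_polyhedron S_bounded V])
      (use z smin vmax in_S_plus_T_iff in auto)
  have "2 * \<mu> * ?\<psi>\<^sup>2 * (f y - f z - (norm (PT (grad y)))\<^sup>2 / (2 * \<mu>))
      \<le> 2 * \<mu> * ?\<psi>\<^sup>2 * (grad y \<bullet> (PS y - PS z) - \<mu> / 2 * ?r\<^sup>2)"
    using gap_bound[OF y z] \<mu>_pos by (intro mult_left_mono) auto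
  also have "\<dots> = 2 * \<mu> * ?\<psi> * (?\<psi> * (grad y \<bullet> (PS y - PS z))) - (\<mu> * ?\<psi> * ?r)\<^sup>2"
    by (simp add: power2_eq_square algebra_simps)
  also have "\<dots> \<le> 2 * \<mu> * ?\<psi> * (?g * ?r) - (\<mu> * ?\<psi> * ?r)\<^sup>2"
    using w \<psi> \<mu>_pos by (intro diff_right_mono mult_left_mono) auto
  also have "\<dots> \<le> ?g\<^sup>2"
    using zero_le_power2[of "?g - \<mu> * ?\<psi> * ?r"] by (simp add: power2_eq_square algebra_simps)
  finally show ?thesis .
qed

text \<open>
  Two distinct points force \<open>\<mu> \<le> L\<close>.  On a single point \<open>\<mu>\<close> and \<open>L\<close> are unrelated.
\<close>
lemma \<mu>\<eta>_le_1:
  assumes "u \<in> S + T" "v \<in> S + T" "u \<noteq> v"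
  shows "\<mu> * \<eta> \<le> 1"
proof -
  have "\<mu> / 2 * (norm (v - u))\<^sup>2 \<le> f v - f u - grad u \<bullet> (v - u)"
    "\<mu> / 2 * (norm (u - v))\<^sup>2 \<le> f u - f v - grad v \<bullet> (u - v)"
    using strong assms by (auto simp: strongly_convex_on_def)
  then have "\<mu> * (norm (u - v))\<^sup>2 \<le> (grad u - grad v) \<bullet> (u - v)"
    by (simp add: norm_minus_commute inner_diff_left inner_diff_right)
  also have "\<dots> \<le> norm (grad u - grad v) * norm (u - v)" by (rule norm_cauchy_schwarz)
  also have "\<dots> \<le> L * norm (u - v) * norm (u - v)"
    using gradient_lipschitz[of u v] S_plus_T_subset_Q assms by (intro mult_right_mono) auto
  finally have "\<mu> \<le> L" using assms(3) by (simp add: power2_eq_square)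
  then have "\<mu> * \<eta> \<le> L * \<eta>" using \<eta>_pos by simp
  then show ?thesis using \<eta>L by (simp add: mult.commute)
qed

text \<open>
  For negative \<open>\<alpha>\<close> the points may leave \<open>S + T\<close>, but by convexity of \<open>S\<close> they are translates of points of
  \<open>S + T\<close> by differences of points of \<open>S\<close>; this is why smoothness is assumed on the larger set.
\<close>
lemma curvature_bdd_above:
  "bdd_above {2 / \<alpha>\<^sup>2 * (f y - f x - grad x \<bullet> (y - x)) | s x y \<alpha>.
            s \<in> S \<and> \<alpha> \<in> {-1..1} - {0} \<and> PS x \<in> S \<and> f x \<le> f x0 \<and>
            y = x + \<alpha> *\<^sub>R (s - PS x)}"
proof -
  obtain D where D: "\<And>a b. a \<in> S \<Longrightarrow> b \<in> S \<Longrightarrow> norm (a - b) \<le> D"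
    using S_bounded unfolding bounded_two_points by (auto simp: dist_norm)
  have "2 / \<alpha>\<^sup>2 * (f (x + \<alpha> *\<^sub>R (s - PS x)) - f x - grad x \<bullet> (\<alpha> *\<^sub>R (s - PS x))) \<le> L * D\<^sup>2"
    if s: "s \<in> S" and \<alpha>: "-1 \<le> \<alpha>" "\<alpha> \<le> 1" "\<alpha> \<noteq> 0" and x: "PS x \<in> S" for s x \<alpha>
  proof -
    let ?p = "PS x"
    have "f (x + \<alpha> *\<^sub>R (s - ?p)) \<le> f x + grad x \<bullet> (\<alpha> *\<^sub>R (s - ?p)) + L / 2 * (norm (\<alpha> *\<^sub>R (s - ?p)))\<^sup>2"
    proof (rule descent_lemma)
      fix t :: real assume t: "0 \<le> t" "t \<le> 1"
      define k where "k = t * \<alpha>"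
      have k: "-1 \<le> k" "k \<le> 1"
      proof -
        have "\<bar>k\<bar> \<le> 1" using t \<alpha> by (auto simp: k_def abs_mult intro!: mult_le_one)
        then show "-1 \<le> k" "k \<le> 1" by auto
      qed
      have "x + k *\<^sub>R (s - ?p) \<in> Q"
      proof (cases "k \<ge> 0")
        case True
        have "(1 - k) *\<^sub>R ?p + k *\<^sub>R s \<in> S" using S_convex True k s x by (simp add: convex_alt)
        then have "?p + ((1 - k) *\<^sub>R ?p + k *\<^sub>R s - ?p) + PT x \<in> Q"
          using x orth_decomp[OF T] by (intro in_QI)
        moreover have "?p + ((1 - k) *\<^sub>R ?p + k *\<^sub>R s - ?p) + PT x = (PT x + ?p) + k *\<^sub>R (s - ?p)"
          by (simp add: algebra_simps)
        ultimately show ?thesis using orth_decomp(3)[OF T, of x] by simp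
      next
        case False
        have "(1 - (- k)) *\<^sub>R ?p + (- k) *\<^sub>R s \<in> S"
          using S_convex False k s x unfolding convex_alt by (meson neg_le_0_iff_le minus_le_iff linear)
        then have "?p + (?p - ((1 - (- k)) *\<^sub>R ?p + (- k) *\<^sub>R s)) + PT x \<in> Q"
          using x orth_decomp[OF T] by (intro in_QI)
        moreover have "?p + (?p - ((1 - (- k)) *\<^sub>R ?p + (- k) *\<^sub>R s)) + PT x = (PT x + ?p) + k *\<^sub>R (s - ?p)"
          by (simp add: algebra_simps)
        ultimately show ?thesis using orth_decomp(3)[OF T, of x] by simp
      qed
      then show "norm (grad (x + t *\<^sub>R \<alpha> *\<^sub>R (s - ?p)) - grad x) \<le> L * norm (t *\<^sub>R \<alpha> *\<^sub>R (s - ?p))"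
        using gradient_lipschitz[of "x + k *\<^sub>R (s - ?p)" x] S_plus_T_subset_Q[of x] in_S_plus_T_iff x
        by (simp add: k_def)
    qed (rule f_diff)
    then have "f (x + \<alpha> *\<^sub>R (s - ?p)) - f x - grad x \<bullet> (\<alpha> *\<^sub>R (s - ?p)) \<le> L / 2 * (\<alpha>\<^sup>2 * (norm (s - ?p))\<^sup>2)"
      by (simp add: power_mult_distrib)
    also have "\<dots> \<le> L / 2 * (\<alpha>\<^sup>2 * D\<^sup>2)"
      using D[OF s x] L_pos by (intro mult_left_mono power_mono) auto
    finally show ?thesis using \<alpha>(3) by (simp add: field_simps)
  qed
  then show ?thesis by (intro bdd_aboveI[of _ "L * D\<^sup>2"]) auto
qed

text \<open>
  One bound for both kinds of direction: a Frank-Wolfe direction has \<open>\<alpha> = t\<close> in the curvature constant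
  and an away direction has \<open>\<alpha> = - t\<close>.
\<close>
lemma curvature_bound:
  assumes y: "PS y \<in> S" "f y \<le> f x0" and s: "s \<in> S" and t: "0 \<le> t" "t \<le> 1"
    and d: "d = s - PS y \<or> d = PS y - s"
  shows "f (y + t *\<^sub>R d) \<le> f y + t * (grad y \<bullet> d) + t\<^sup>2 / 2 * curvature_const T S f x0"
proof (cases "t = 0")
  case False
  obtain \<alpha> where \<alpha>: "\<alpha> \<in> {-1..1} - {0}" "t *\<^sub>R d = \<alpha> *\<^sub>R (s - PS y)" "\<alpha>\<^sup>2 = t\<^sup>2"
    using d
  proof
    assume "d = s - PS y"
    then show ?thesis using that[of t] t False by auto
  next
    assume "d = PS y - s"
    then have "t *\<^sub>R d = (- t) *\<^sub>R (s - PS y)"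
      by (simp add: scaleR_diff_right)
    then show ?thesis using that[of "- t"] t False by auto
  qed
  have "2 / \<alpha>\<^sup>2 * (f (y + t *\<^sub>R d) - f y - grad y \<bullet> (y + t *\<^sub>R d - y)) \<le> curvature_const T S f x0"
    unfolding curvature_const_def
    by (rule cSup_upper[OF _ curvature_bdd_above], intro CollectI exI[of _ s] exI[of _ y] exI[of _ "y + t *\<^sub>R d"] exI[of _ \<alpha>])
      (use \<alpha> s y in auto)
  then have "2 / t\<^sup>2 * (f (y + t *\<^sub>R d) - f y - t * (grad y \<bullet> d)) \<le> curvature_const T S f x0"
    using \<alpha>(3) by simp
  then show ?thesis using False by (simp add: field_simps)
qed simp

lemma curvature_nonneg:
  assumes "PS x0 \<in> S"
  shows "0 \<le> curvature_const T S f x0"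
proof -
  have "2 / 1\<^sup>2 * (f x0 - f x0 - grad x0 \<bullet> (x0 - x0)) \<le> curvature_const T S f x0"
    unfolding curvature_const_def
  proof (rule cSup_upper[OF _ curvature_bdd_above])
    show "2 / 1\<^sup>2 * (f x0 - f x0 - grad x0 \<bullet> (x0 - x0)) \<in>
      {2 / \<alpha>\<^sup>2 * (f y - f x - grad x \<bullet> (y - x)) | s x y \<alpha>.
            s \<in> S \<and> \<alpha> \<in> {-1..1} - {0} \<and> PS x \<in> S \<and> f x \<le> f x0 \<and> y = x + \<alpha> *\<^sub>R (s - PS x)}"
      using assms by (intro CollectI exI[of _ "PS x0"] exI[of _ x0] exI[of _ 1]) auto
  qed
  then show ?thesis by simp
qed

section \<open>Progress of the iteration\<close>

text \<open>
  A common description of both kinds of step.  The method picks the direction with the larger slope, so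
  this slope is at least half of the pairwise gap and at least the Frank-Wolfe gap.  The final
  alternative separates the steps whose line search competes with all step sizes in \<open>[0, 1]\<close>
  from those that drop a vertex.
\<close>
lemma uafw_step_progress:
  assumes step: "uafw_step T S f \<eta> x V w y x' V' w'"
    and rep: "active_rep S V w (PS x)"
  obtains s v d \<alpha> where
    "y \<in> S + T" "PS y = PS x" "y = x - \<eta> *\<^sub>R PT (grad x)"
    "s \<in> S" "\<And>z. z \<in> S \<Longrightarrow> grad y \<bullet> s \<le> grad y \<bullet> z"
    "v \<in> V" "\<And>z. z \<in> V \<Longrightarrow> grad y \<bullet> z \<le> grad y \<bullet> v"
    "d = s - PS y \<or> d = PS y - v"
    "grad y \<bullet> (v - s) \<le> - 2 * (grad y \<bullet> d)" "grad y \<bullet> (PS y - s) \<le> - (grad y \<bullet> d)"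
    "x' = y + \<alpha> *\<^sub>R d" "0 \<le> \<alpha>" "\<And>t. 0 \<le> t \<Longrightarrow> t \<le> \<alpha> \<Longrightarrow> f x' \<le> f (y + t *\<^sub>R d)"
    "active_rep S V' w' (PS x')"
    "(card V' \<le> card V + 1 \<and> (\<forall>t. 0 \<le> t \<and> t \<le> 1 \<longrightarrow> f x' \<le> f (y + t *\<^sub>R d)))
      \<or> card V' + 1 = card V"
proof -
  have yeq: "y = x - \<eta> *\<^sub>R PT (grad x)" using step by (simp add: uafw_step_def)
  obtain s v where s: "s \<in> vertices S" and smin: "is_arg_min (\<lambda>z. grad y \<bullet> z) (\<lambda>z. z \<in> S) s"
    and vmax: "is_arg_max (\<lambda>z. grad y \<bullet> z) (\<lambda>z. z \<in> V) v"
    and upd: "if grad y \<bullet> (s - PS x) < grad y \<bullet> (PS x - v)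
         then frank_wolfe_update f y (PS x) s V w x' V' w'
         else away_update f y (PS x) v V w x' V' w'"
    using step unfolding uafw_step_def by blast
  have V: "finite V" "V \<subseteq> vertices S" "\<And>v. v \<in> V \<Longrightarrow> 0 \<le> w v" "sum w V = 1"
    using rep by (auto simp: active_rep_def)
  have "- (\<eta> *\<^sub>R PT (grad x)) \<in> T" using orth_decomp(1)[OF T] subspace_scale[OF T] subspace_neg[OF T] by blast
  then have PSy: "PS y = PS x" using PS_add_T[of "- (\<eta> *\<^sub>R PT (grad x))" x] yeq by simp
  have pS: "PS x \<in> S" using active_rep_in[OF rep S_convex] .
  have yS: "y \<in> S + T" using pS PSy in_S_plus_T_iff by simp
  have sS: "s \<in> S" and smin': "\<And>z. z \<in> S \<Longrightarrow> grad y \<bullet> s \<le> grad y \<bullet> z"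
    using smin by (auto simp: is_arg_min_linorder)
  have vV: "v \<in> V" and vmax': "\<And>z. z \<in> V \<Longrightarrow> grad y \<bullet> z \<le> grad y \<bullet> v"
    using vmax by (auto simp: is_arg_max_linorder)
  have vS: "v \<in> S" using vV V(2) by (auto simp: vertices_def extreme_point_of_def)
  have comp: "a - b \<in> T\<^sup>\<bottom>" if "a \<in> S" "b \<in> S" for a b
    using that S_orth subspace_diff[OF subspace_orthogonal_comp] by blast
  have PSx': "PS (y + \<alpha> *\<^sub>R (a - b)) = PS x + \<alpha> *\<^sub>R (a - b)" if "a \<in> S" "b \<in> S" for \<alpha> a b
    using PS_add_comp[OF subspace_scale[OF subspace_orthogonal_comp comp[OF that]]] PSy by simp
  show ?thesis
  proof (cases "grad y \<bullet> (s - PS x) < grad y \<bullet> (PS x - v)")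
    case True
    then have "frank_wolfe_update f y (PS x) s V w x' V' w'" using upd by simp
    then obtain \<alpha> where ls: "exact_line_search f y (s - PS x) 1 \<alpha>"
      and x': "x' = y + \<alpha> *\<^sub>R (s - PS x)" and V': "V' = (if \<alpha> = 1 then {s} else V \<union> {s})"
      and ws: "w' s = (1 - \<alpha>) * (if s \<in> V then w s else 0) + \<alpha>"
      and wu: "\<forall>u \<in> V - {s}. w' u = (1 - \<alpha>) * w u"
      unfolding frank_wolfe_update_def by blast
    have \<alpha>: "0 \<le> \<alpha>" "\<alpha> \<le> 1" and opt: "\<And>t. 0 \<le> t \<Longrightarrow> t \<le> 1 \<Longrightarrow> f x' \<le> f (y + t *\<^sub>R (s - PS x))"
      using ls by (auto simp: exact_line_search_def is_arg_min_linorder x')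
    have rep': "active_rep S V' w' (PS x')"
      using active_rep_frank_wolfe[OF rep s \<alpha> V' ws wu] PSx'[OF sS pS] by (simp add: x')
    have "card V' \<le> card V + 1"
    proof (cases "\<alpha> = 1")
      case True
      then show ?thesis by (simp add: V')
    next
      case False
      then show ?thesis using V(1) by (simp add: V' card_insert_if)
    qed
    then have cards: "(card V' \<le> card V + 1 \<and> (\<forall>t. 0 \<le> t \<and> t \<le> 1 \<longrightarrow> f x' \<le> f (y + t *\<^sub>R (s - PS x))))
      \<or> card V' + 1 = card V"
      using opt by simp
    have opt': "\<And>t. 0 \<le> t \<Longrightarrow> t \<le> \<alpha> \<Longrightarrow> f x' \<le> f (y + t *\<^sub>R (s - PS x))"
      using opt \<alpha>(2) by simp
    have dir: "s - PS x = s - PS y \<or> s - PS x = PS y - v" by (simp add: PSy)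
    have gap: "grad y \<bullet> (v - s) \<le> - 2 * (grad y \<bullet> (s - PS x))"
      "grad y \<bullet> (PS y - s) \<le> - (grad y \<bullet> (s - PS x))"
      using True by (simp_all add: PSy inner_diff_right)
    show ?thesis
      by (rule that[OF yS PSy yeq sS smin' vV vmax' dir gap x' \<alpha>(1) opt' rep' cards])
  next
    case False
    then have "away_update f y (PS x) v V w x' V' w'" using upd by simp
    then obtain \<alpha> amax where amax: "amax = (if w v = 1 then \<infinity> else ereal (w v / (1 - w v)))"
      and ls: "exact_line_search f y (PS x - v) amax \<alpha>"
      and x': "x' = y + \<alpha> *\<^sub>R (PS x - v)" and V': "V' = (if ereal \<alpha> = amax then V - {v} else V)"
      and wv: "w' v = (1 + \<alpha>) * w v - \<alpha>"
      and wu: "\<forall>u \<in> V - {v}. w' u = (1 + \<alpha>) * w u"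
      unfolding away_update_def by blast
    have \<alpha>: "0 \<le> \<alpha>" "ereal \<alpha> \<le> amax"
      and opt: "\<And>t. 0 \<le> t \<Longrightarrow> ereal t \<le> amax \<Longrightarrow> f x' \<le> f (y + t *\<^sub>R (PS x - v))"
      using ls by (auto simp: exact_line_search_def is_arg_min_linorder x')
    have "w v \<le> 1" using member_le_sum[OF vV, of w] V by simp
    have a1: "\<alpha> * (1 - w v) \<le> w v" "ereal \<alpha> = amax \<Longrightarrow> \<alpha> * (1 - w v) = w v"
    proof -
      have "\<alpha> * (1 - w v) \<le> w v \<and> (ereal \<alpha> = amax \<longrightarrow> \<alpha> * (1 - w v) = w v)"
      proof (cases "w v = 1")
        case True
        then show ?thesis using amax by simp
      next
        case False
        then have "0 < 1 - w v" "amax = ereal (w v / (1 - w v))" using \<open>w v \<le> 1\<close> amax by simp_all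
        then show ?thesis using \<alpha>(2) by (simp add: pos_le_divide_eq nonzero_eq_divide_eq)
      qed
      then show "\<alpha> * (1 - w v) \<le> w v" "ereal \<alpha> = amax \<Longrightarrow> \<alpha> * (1 - w v) = w v" by blast+
    qed
    have rep': "active_rep S V' w' (PS x')"
      using active_rep_away[OF rep vV \<alpha>(1) a1(1) _ wv wu, of V'] V' a1(2) PSx'[OF pS vS] by (simp add: x')
    have cards: "(card V' \<le> card V + 1 \<and> (\<forall>t. 0 \<le> t \<and> t \<le> 1 \<longrightarrow> f x' \<le> f (y + t *\<^sub>R (PS x - v))))
      \<or> card V' + 1 = card V"
    proof (cases "ereal \<alpha> = amax")
      case True
      then have "card V' + 1 = card V" using V' V(1) vV card_Suc_Diff1 by fastforce
      then show ?thesis ..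
    next
      case ne: False
      have "f x' \<le> f (y + t *\<^sub>R (PS x - v))" if t: "0 \<le> t" for t
      proof (cases amax)
        case (real m)
        have "\<alpha> < m" using \<alpha>(2) ne real by simp
        then show ?thesis
          using convex_interior_minimum_extends[OF convex_on_line[OF f_convex, of y "PS x - v"], of m \<alpha> t]
            opt real \<alpha>(1) t x' by simp
      next
        case PInf
        then show ?thesis using opt t by simp
      next
        case MInf
        then show ?thesis using \<alpha> by simp
      qed
      then show ?thesis using ne V' by simp
    qed
    have opt': "f x' \<le> f (y + t *\<^sub>R (PS x - v))" if "0 \<le> t" "t \<le> \<alpha>" for t
    proof -
      have "ereal t \<le> ereal \<alpha>" using that(2) by simp
      then show ?thesis using opt[OF that(1)] \<alpha>(2) order_trans by blast
    qed
    have dir: "PS x - v = s - PS y \<or> PS x - v = PS y - v" by (simp add: PSy)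
    have gap: "grad y \<bullet> (v - s) \<le> - 2 * (grad y \<bullet> (PS x - v))"
      "grad y \<bullet> (PS y - s) \<le> - (grad y \<bullet> (PS x - v))"
      using False by (simp_all add: PSy inner_diff_right)
    show ?thesis
      by (rule that[OF yS PSy yeq sS smin' vV vmax' dir gap x' \<alpha>(1) opt' rep' cards])
  qed
qed

definition progress_factor :: "'a \<Rightarrow> real" where
  "progress_factor x0 = (if is_singleton S then 1 / 2
     else min (1 / 2) (\<mu> * (facial_distance S)\<^sup>2 / 4 / curvature_const T S f x0))"

lemma progress_factor_range:
  assumes "PS x0 \<in> S"
  shows "0 \<le> progress_factor x0" "progress_factor x0 \<le> 1 / 2"
proof -
  have "0 \<le> \<mu> * (facial_distance S)\<^sup>2 / 4 / curvature_const T S f x0"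
    using curvature_nonneg[OF assms] \<mu>_pos by simp
  then show "0 \<le> progress_factor x0" by (simp add: progress_factor_def)
  show "progress_factor x0 \<le> 1 / 2"
    by (cases "is_singleton S") (simp_all only: progress_factor_def if_True if_False min.cobounded1 order_refl)
qed

text \<open>
  The quadratic upper model \<open>f y - t e + t\<^sup>2 C / 2\<close> is minimised over \<open>[0, 1]\<close>.  If the minimum is at
  \<open>t = 1\<close>, half of the slope \<open>e\<close> is gained, and \<open>e\<close> dominates the gap within \<open>S\<close>; otherwise the gain
  is \<open>e\<^sup>2 / (2 C)\<close>, which the facial distance bound compares with the gap.  If \<open>S\<close> is a point, the gap
  within \<open>S\<close> is zero.
\<close>
lemma line_search_decrease:
  assumes x0: "PS x0 \<in> S" and y: "y \<in> S + T" "f y \<le> f x0" and z: "z \<in> S + T"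
    and V: "V \<subseteq> vertices S" "PS y \<in> convex hull V" "v \<in> V" and s: "s \<in> S"
    and smin: "\<And>z. z \<in> S \<Longrightarrow> grad y \<bullet> s \<le> grad y \<bullet> z"
    and vmax: "\<And>z. z \<in> V \<Longrightarrow> grad y \<bullet> z \<le> grad y \<bullet> v"
    and d: "d = s - PS y \<or> d = PS y - v"
    and gap: "grad y \<bullet> (v - s) \<le> - 2 * (grad y \<bullet> d)" "grad y \<bullet> (PS y - s) \<le> - (grad y \<bullet> d)"
    and opt: "\<And>t. 0 \<le> t \<Longrightarrow> t \<le> 1 \<Longrightarrow> f x' \<le> f (y + t *\<^sub>R d)"
  shows "progress_factor x0 * (f y - f z - (norm (PT (grad y)))\<^sup>2 / (2 * \<mu>)) \<le> f y - f x'"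
proof -
  define C where "C = curvature_const T S f x0"
  define e where "e = - (grad y \<bullet> d)"
  define g where "g = grad y \<bullet> (v - s)"
  define H where "H = f y - f z - (norm (PT (grad y)))\<^sup>2 / (2 * \<mu>)"
  define \<rho> where "\<rho> = progress_factor x0"
  have pS: "PS y \<in> S" "PS z \<in> S" using y z in_S_plus_T_iff by auto
  have vS: "v \<in> S" using V by (auto simp: vertices_def extreme_point_of_def)
  have g0: "0 \<le> g" using smin[OF vS] by (simp add: g_def inner_diff_right)
  have eg: "g \<le> 2 * e" using gap(1) by (simp add: g_def e_def)
  have He: "H \<le> e"
  proof -
    have "H \<le> grad y \<bullet> (PS y - PS z) - \<mu> / 2 * (norm (PS y - PS z))\<^sup>2"
      using gap_bound[OF y(1) z] by (simp add: H_def)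
    also have "\<dots> \<le> grad y \<bullet> (PS y - PS z)" using \<mu>_pos by simp
    also have "\<dots> \<le> grad y \<bullet> (PS y - s)" using smin[OF pS(2)] by (simp add: inner_diff_right)
    finally show ?thesis using gap(2) by (simp add: e_def)
  qed
  have Hg: "2 * \<mu> * (facial_distance S)\<^sup>2 * H \<le> g\<^sup>2"
    unfolding H_def g_def by (rule gap_bound_width[OF y(1) z V(1,2) smin vmax])
  have dec: "t * e - t\<^sup>2 / 2 * C \<le> f y - f x'" if t: "0 \<le> t" "t \<le> 1" for t
    using d
  proof
    assume "d = s - PS y"
    then show ?thesis using curvature_bound[OF pS(1) y(2) s t, of d] opt[OF t] by (simp add: C_def e_def)
  next
    assume "d = PS y - v"
    then show ?thesis using curvature_bound[OF pS(1) y(2) vS t, of d] opt[OF t] by (simp add: C_def e_def)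
  qed
  have \<rho>: "0 \<le> \<rho>" "\<rho> \<le> 1 / 2"
    using progress_factor_range[OF x0] by (simp_all add: \<rho>_def)
  have D0: "0 \<le> f y - f x'" using dec[of 0] by simp
  show ?thesis unfolding H_def[symmetric] \<rho>_def[symmetric]
  proof (cases "H \<le> 0")
    case True
    then show "\<rho> * H \<le> f y - f x'" using \<rho> D0 by (meson mult_nonneg_nonpos order_trans)
  next
    case False
    show "\<rho> * H \<le> f y - f x'"
    proof (cases "C \<le> e")
      case True
      have "\<rho> * H \<le> 1 / 2 * e" using \<rho> He False by (intro mult_mono) auto
      also have "\<dots> \<le> f y - f x'" using dec[of 1] True by simp
      finally show ?thesis .
    next
      case Ce: False
      have C0: "C > 0" using Ce g0 eg by linarith
      have ns: "\<not> is_singleton S"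
      proof
        assume "is_singleton S"
        then obtain a where "S = {a}" by (rule is_singletonE)
        then have "d = 0" using d s vS pS by auto
        then show False using He False by (simp add: e_def)
      qed
      have "\<rho> \<le> \<mu> * (facial_distance S)\<^sup>2 / 4 / C" using ns by (simp add: \<rho>_def progress_factor_def C_def)
      then have "\<rho> * H \<le> \<mu> * (facial_distance S)\<^sup>2 / 4 / C * H" using False by (intro mult_right_mono) auto
      also have "\<dots> = (2 * \<mu> * (facial_distance S)\<^sup>2 * H) / (8 * C)" by simp
      also have "\<dots> \<le> g\<^sup>2 / (8 * C)" using Hg C0 by (intro divide_right_mono) auto
      also have "\<dots> \<le> (2 * e)\<^sup>2 / (8 * C)" using g0 eg C0 by (intro divide_right_mono power_mono) auto
      also have "\<dots> = e / C * e - (e / C)\<^sup>2 / 2 * C" using C0 by (simp add: power2_eq_square field_simps)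
      also have "\<dots> \<le> f y - f x'" using Ce C0 g0 eg by (intro dec) (auto simp: field_simps)
      finally show ?thesis .
    qed
  qed
qed

section \<open>Linear convergence\<close>

text \<open>
  On a step that drops no vertex, the gap at \<open>y\<close> contracts.  The weight \<open>\<mu>\<eta> / 4\<close> on the gain of the
  line search is small enough for the gain \<open>\<eta> N / 4\<close> to absorb the loss term \<open>\<rho> N / (2\<mu>)\<close>.
\<close>
lemma uafw_gap_step:
  assumes step: "uafw_step T S f \<eta> x V w y x' V' w'" and step': "uafw_step T S f \<eta> x' V' w' y' x'' V'' w''"
    and rep: "active_rep S V w (PS x)" and fx: "f x \<le> f x0" and x0: "PS x0 \<in> S"
    and \<mu>\<eta>: "\<mu> * \<eta> \<le> 1"
  shows "f x' \<le> f x0" "f y' \<le> f y"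
    "(card V' \<le> card V + 1 \<and>
        (\<forall>z\<in>S + T. f y' - f z \<le> (1 - progress_factor x0 * (\<mu> * \<eta> / 4)) * (f y - f z)))
      \<or> card V' + 1 = card V"
proof -
  obtain s v d \<alpha> where
    y: "y \<in> S + T" "PS y = PS x" "y = x - \<eta> *\<^sub>R PT (grad x)"
    and s: "s \<in> S" "\<And>z. z \<in> S \<Longrightarrow> grad y \<bullet> s \<le> grad y \<bullet> z"
    and v: "v \<in> V" "\<And>z. z \<in> V \<Longrightarrow> grad y \<bullet> z \<le> grad y \<bullet> v"
    and d: "d = s - PS y \<or> d = PS y - v"
    "grad y \<bullet> (v - s) \<le> - 2 * (grad y \<bullet> d)" "grad y \<bullet> (PS y - s) \<le> - (grad y \<bullet> d)"
    and x': "x' = y + \<alpha> *\<^sub>R d" "0 \<le> \<alpha>" "\<And>t. 0 \<le> t \<Longrightarrow> t \<le> \<alpha> \<Longrightarrow> f x' \<le> f (y + t *\<^sub>R d)"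
    and rep': "active_rep S V' w' (PS x')"
    and cases: "(card V' \<le> card V + 1 \<and> (\<forall>t. 0 \<le> t \<and> t \<le> 1 \<longrightarrow> f x' \<le> f (y + t *\<^sub>R d)))
      \<or> card V' + 1 = card V"
    using uafw_step_progress[OF step rep] by metis
  have xS: "x \<in> S + T" using active_rep_in[OF rep S_convex] in_S_plus_T_iff by simp
  have x'S: "x' \<in> S + T" using active_rep_in[OF rep' S_convex] in_S_plus_T_iff by simp
  have yeq': "y' = x' - \<eta> *\<^sub>R PT (grad x')" using step' by (simp add: uafw_step_def)
  have fy: "f y \<le> f x" using gradient_step_decrease[OF xS] y(3) \<eta>_pos
    by (smt (verit) divide_nonneg_pos mult_nonneg_nonneg zero_le_power2)
  have fx': "f x' \<le> f y" using x'(3)[of 0] x'(2) by simp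
  have fy': "f y' \<le> f x'" using gradient_step_decrease[OF x'S] yeq' \<eta>_pos
    by (smt (verit) divide_nonneg_pos mult_nonneg_nonneg zero_le_power2)
  show "f x' \<le> f x0" using fy fx' fx by simp
  show "f y' \<le> f y" using fx' fy' by simp
  have "0 \<le> grad x' \<bullet> (y - x')"
  proof (rule gradient_nonneg_towards_segment_end[OF f_diff])
    fix t :: real assume t: "0 \<le> t" "t \<le> 1"
    have "x' + t *\<^sub>R (y - x') = y + ((1 - t) * \<alpha>) *\<^sub>R d" by (simp add: x'(1) algebra_simps)
    moreover have "0 \<le> (1 - t) * \<alpha>" "(1 - t) * \<alpha> \<le> \<alpha>"
      using t x'(2) by (simp_all add: mult_left_le_one_le)
    ultimately show "f x' \<le> f (x' + t *\<^sub>R (y - x'))" using x'(3) by simp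
  qed
  then have G: "\<eta> / 4 * (norm (PT (grad y)))\<^sup>2 \<le> f y - f y'"
    using two_phase_decrease[OF y(1) x'S] yeq' by simp
  define N where "N = (norm (PT (grad y)))\<^sup>2"
  define \<rho> where "\<rho> = progress_factor x0"
  have \<rho>: "0 \<le> \<rho>" "\<rho> \<le> 1 / 2" using progress_factor_range[OF x0] by (simp_all add: \<rho>_def)
  have "f y' - f z \<le> (1 - \<rho> * (\<mu> * \<eta> / 4)) * (f y - f z)"
    if z: "z \<in> S + T" and opt: "\<forall>t. 0 \<le> t \<and> t \<le> 1 \<longrightarrow> f x' \<le> f (y + t *\<^sub>R d)" for z
  proof -
    have "V \<subseteq> vertices S" using rep by (simp add: active_rep_def)
    then have "\<rho> * (f y - f z - N / (2 * \<mu>)) \<le> f y - f x'"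
      unfolding \<rho>_def N_def
      using line_search_decrease[OF x0 y(1) _ z _ _ v(1) s(1) s(2) v(2) d] opt
        active_rep_convex_hull[OF rep] y(2) fy fx by fastforce
    then have D: "\<rho> * (f y - f z - N / (2 * \<mu>)) \<le> f y - f y'" using fy' by simp
    define \<theta> where "\<theta> = \<mu> * \<eta> / 4"
    have \<theta>: "0 \<le> \<theta>" "\<theta> \<le> 1 / 4" using \<mu>_pos \<eta>_pos \<mu>\<eta> by (simp_all add: \<theta>_def)
    have N0: "0 \<le> N" by (simp add: N_def)
    have "\<theta> * (\<rho> * (f y - f z - N / (2 * \<mu>))) + (1 - \<theta>) * (\<eta> / 4 * N) \<le> \<theta> * (f y - f y') + (1 - \<theta>) * (f y - f y')"
      using D G \<theta> by (intro add_mono mult_left_mono) (auto simp: N_def)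
    also have "\<dots> = f y - f y'" by (simp add: algebra_simps)
    finally have 1: "\<theta> * (\<rho> * (f y - f z - N / (2 * \<mu>))) + (1 - \<theta>) * (\<eta> / 4 * N) \<le> f y - f y'" .
    have "\<theta> * (\<rho> * (N / (2 * \<mu>))) = \<rho> * (\<eta> * N / 8)" using \<mu>_pos by (simp add: \<theta>_def field_simps)
    also have "\<dots> \<le> 1 / 2 * (\<eta> * N / 8)" using \<rho> N0 \<eta>_pos by (intro mult_right_mono) auto
    also have "\<dots> \<le> (3 / 4) * (\<eta> / 4 * N)" using N0 \<eta>_pos by simp
    also have "\<dots> \<le> (1 - \<theta>) * (\<eta> / 4 * N)" using \<theta> N0 \<eta>_pos by (intro mult_right_mono) auto
    finally have "\<theta> * (\<rho> * (N / (2 * \<mu>))) \<le> (1 - \<theta>) * (\<eta> / 4 * N)" .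
    moreover have "\<theta> * (\<rho> * (f y - f z - N / (2 * \<mu>)))
        = \<theta> * \<rho> * (f y - f z) - \<theta> * (\<rho> * (N / (2 * \<mu>)))"
      by (simp only: right_diff_distrib mult.assoc)
    ultimately have "\<theta> * \<rho> * (f y - f z) \<le> f y - f y'" using 1 by linarith
    moreover have "(1 - \<rho> * \<theta>) * (f y - f z) = (f y - f z) - \<theta> * \<rho> * (f y - f z)"
      by (simp add: algebra_simps)
    ultimately show ?thesis unfolding \<theta>_def[symmetric] by linarith
  qed
  then show "(card V' \<le> card V + 1 \<and>
        (\<forall>z\<in>S + T. f y' - f z \<le> (1 - progress_factor x0 * (\<mu> * \<eta> / 4)) * (f y - f z)))
      \<or> card V' + 1 = card V"
    using cases by (auto simp: \<rho>_def)
qed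

lemma uafw_sequence_active_rep:
  assumes seq: "uafw_sequence T S f \<eta> x0 x y" and x0: "PS x0 \<in> vertices S"
  obtains V w where "x 0 = x0" "V 0 = {PS x0}"
    "\<And>k. uafw_step T S f \<eta> (x k) (V k) (w k) (y k) (x (Suc k)) (V (Suc k)) (w (Suc k))"
    "\<And>k. active_rep S (V k) (w k) (PS (x k))"
proof -
  obtain V w where init: "x 0 = x0" "V 0 = {PS x0}" "w 0 (PS x0) = (1::real)"
    and step: "\<And>k. uafw_step T S f \<eta> (x k) (V k) (w k) (y k) (x (Suc k)) (V (Suc k)) (w (Suc k))"
    using seq unfolding uafw_sequence_def by blast
  have "active_rep S (V k) (w k) (PS (x k))" for k
  proof (induction k)
    case 0
    show ?case using init x0 by (simp add: active_rep_def)
  next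
    case (Suc k)
    then show ?case using uafw_step_progress[OF step[of k]] by metis
  qed
  then show ?thesis using that init(1,2) step by blast
qed

text \<open>
  The induction counts the contracting steps \<open>m\<close>.  The quantity \<open>2 m + 1 - card (V k) - k\<close> never becomes
  negative: a contracting step raises \<open>2 m\<close> by 2 and both \<open>card (V k)\<close> and \<open>k\<close> by at most 1, while a drop
  step lowers \<open>card (V k)\<close> and raises \<open>k\<close> by 1.  As \<open>card (V k) \<ge> 1\<close>, this gives \<open>k \<le> 2 m\<close>.
\<close>
lemma uafw_linear_rate:
  assumes seq: "uafw_sequence T S f \<eta> x0 x y" and x0: "PS x0 \<in> vertices S"
    and \<mu>\<eta>: "\<mu> * \<eta> \<le> 1"
    and z: "z \<in> S + T" and zmin: "\<And>u. u \<in> S + T \<Longrightarrow> f z \<le> f u"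
  shows "f (y k) - f z \<le> (1 - progress_factor x0 * (\<mu> * \<eta> / 4)) powr (real k / 2) * (f (y 0) - f z)"
proof -
  define q where "q = 1 - progress_factor x0 * (\<mu> * \<eta> / 4)"
  have x0S: "PS x0 \<in> S" using x0 by (auto simp: vertices_def extreme_point_of_def)
  have q: "0 < q" "q \<le> 1"
  proof -
    have "0 \<le> progress_factor x0 * (\<mu> * \<eta> / 4)" "progress_factor x0 * (\<mu> * \<eta> / 4) \<le> 1 / 2 * (1 / 4)"
      using progress_factor_range[OF x0S] \<mu>_pos \<eta>_pos \<mu>\<eta> by (simp, intro mult_mono) auto
    then show "0 < q" "q \<le> 1" unfolding q_def by linarith+
  qed
  obtain V w where init: "x 0 = x0" "V 0 = {PS x0}"
    and step: "\<And>k. uafw_step T S f \<eta> (x k) (V k) (w k) (y k) (x (Suc k)) (V (Suc k)) (w (Suc k))"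
    and rep: "\<And>k. active_rep S (V k) (w k) (PS (x k))"
    using uafw_sequence_active_rep[OF seq x0] by metis
  have level: "f (x k) \<le> f x0" for k
  proof (induction k)
    case 0
    show ?case using init by simp
  next
    case (Suc k)
    then show ?case using uafw_gap_step(1)[OF step step rep _ x0S \<mu>\<eta>] by blast
  qed
  have nonneg: "0 \<le> f (y k) - f z" for k
    using zmin uafw_step_progress[OF step rep] by (metis diff_ge_0_iff_ge)
  have "\<exists>m. f (y k) - f z \<le> q ^ m * (f (y 0) - f z) \<and> k + card (V k) \<le> 2 * m + 1" for k
  proof (induction k)
    case 0
    show ?case by (rule exI[of _ 0]) (simp add: init)
  next
    case (Suc k)
    then obtain m where m: "f (y k) - f z \<le> q ^ m * (f (y 0) - f z)" "k + card (V k) \<le> 2 * m + 1" by blast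
    note gs = uafw_gap_step(2,3)[OF step step rep level x0S \<mu>\<eta>, of k]
    from gs(2) show ?case
    proof
      assume good: "card (V (Suc k)) \<le> card (V k) + 1 \<and>
        (\<forall>z\<in>S + T. f (y (Suc k)) - f z \<le> (1 - progress_factor x0 * (\<mu> * \<eta> / 4)) * (f (y k) - f z))"
      then have "f (y (Suc k)) - f z \<le> q * (f (y k) - f z)" using z by (auto simp: q_def)
      also have "\<dots> \<le> q * (q ^ m * (f (y 0) - f z))" using m(1) q by (intro mult_left_mono) auto
      finally show ?thesis using good m(2) by (intro exI[of _ "Suc m"]) (auto simp: mult.assoc)
    next
      assume "card (V (Suc k)) + 1 = card (V k)"
      then show ?thesis using m gs(1) by (intro exI[of _ m]) auto
    qed
  qed
  then obtain m where m: "f (y k) - f z \<le> q ^ m * (f (y 0) - f z)" "k + card (V k) \<le> 2 * m + 1" by blast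
  have "finite (V k)" "V k \<noteq> {}" using rep[of k] by (auto simp: active_rep_def)
  then have "card (V k) \<ge> 1" by (simp add: Suc_le_eq card_gt_0_iff)
  then have "real k / 2 \<le> real m" using m(2) by simp
  then have "q powr real m \<le> q powr (real k / 2)" using q by (intro powr_mono') auto
  then have "q ^ m * (f (y 0) - f z) \<le> q powr (real k / 2) * (f (y 0) - f z)"
    using nonneg[of 0] q by (intro mult_right_mono) (simp_all add: powr_realpow)
  then show ?thesis using m(1) by (simp add: q_def)
qed

lemma minimizer_exists:
  assumes "bounded {z. f z \<le> f x0}" "x0 \<in> S + T"
  obtains z where "z \<in> S + T" "\<And>u. u \<in> S + T \<Longrightarrow> f z \<le> f u"
proof -
  let ?K = "(S + T) \<inter> {z. f z \<le> f x0}"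
  have cont: "continuous_on UNIV f"
    using f_diff differentiable_imp_continuous_within continuous_at_imp_continuous_on by blast
  have "compact S" using S_bounded S_polyhedron polyhedron_imp_closed compact_eq_bounded_closed by blast
  then have "closed (\<Union>x\<in>S. \<Union>y\<in>T. {x + y})" using compact_closed_sums closed_subspace[OF T] by blast
  moreover have "(\<Union>x\<in>S. \<Union>y\<in>T. {x + y}) = S + T" by (auto simp: set_plus_def)
  ultimately have "closed (S + T)" by simp
  moreover have "closed {z. f z \<le> f x0}"
    using cont by (intro closed_Collect_le continuous_on_const)
  ultimately have "compact ?K"
    using assms(1) bounded_subset[of _ ?K] by (simp add: compact_eq_bounded_closed closed_Int)
  moreover have "x0 \<in> ?K" using assms(2) by simp
  moreover have "continuous_on ?K f" using cont continuous_on_subset by blast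
  ultimately obtain z where z: "z \<in> ?K" "\<forall>u\<in>?K. f z \<le> f u"
    using continuous_attains_inf[of ?K f] by blast
  have "f z \<le> f u" if "u \<in> S + T" for u
    using z that by (cases "f u \<le> f x0") auto
  then show ?thesis using that z by blast
qed

end

theorem theorem3p8:
  fixes T S :: "(real ^ 'n) set"
    and f :: "real ^ 'n \<Rightarrow> real"
    and x0 :: "real ^ 'n"
    and x y :: "nat \<Rightarrow> real ^ 'n"
    and L \<mu> \<eta> \<sigma> fstar :: real
  assumes "subspace T"
    and "S \<subseteq> T\<^sup>\<bottom>"
    and "convex S"
    and "convex_on UNIV f"
    and "continuously_differentiable f"
    and "x0 \<in> T + S"
    and "orth_proj (T\<^sup>\<bottom>) x0 \<in> vertices S"
    and "bounded S" and "polyhedron S"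
    and "bounded {z. f z \<le> f x0}"
    and "smooth_over L ({a + (b - c) | a b c. a \<in> S \<and> b \<in> S \<and> c \<in> S} + T) f"
    and "\<mu> > 0"
    and "strongly_convex_on \<mu> (S + T) f"
    and "\<eta> > 0" and "\<eta> \<le> 1 / L"
    and "uafw_sequence T S f \<eta> x0 x y"
    and "fstar = (INF z \<in> T + S. f z)"
    and "\<sigma> = \<mu> * (facial_distance S)\<^sup>2 / 4"
  shows "\<forall>k. f (y k) - fstar
           \<le> (1 - (if is_singleton S then 1 / 2 else min (1 / 2) (\<sigma> / curvature_const T S f x0))
                   * (\<mu> * \<eta> / 4)) powr (real k / 2)
             * (f (y 0) - fstar)"
proof
  fix k
  have x0S: "orth_proj (T\<^sup>\<bottom>) x0 \<in> S"
    using assms(7) by (auto simp: vertices_def extreme_point_of_def)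
  interpret polytope_plus_subspace T S f L \<mu> \<eta>
    by unfold_locales (use assms x0S in \<open>auto simp: continuously_differentiable_def\<close>)
  have TS: "T + S = S + T" by (simp add: add.commute)
  obtain z where z: "z \<in> S + T" "\<And>u. u \<in> S + T \<Longrightarrow> f z \<le> f u"
    using minimizer_exists[of x0] assms(6,10) TS by auto
  have fstar: "fstar = f z"
    unfolding assms(17) TS by (rule cInf_eq_minimum) (use z in auto)
  show "f (y k) - fstar
           \<le> (1 - (if is_singleton S then 1 / 2 else min (1 / 2) (\<sigma> / curvature_const T S f x0))
                   * (\<mu> * \<eta> / 4)) powr (real k / 2)
             * (f (y 0) - fstar)"
  proof (cases "\<mu> * \<eta> \<le> 1")
    case True
    show ?thesis
      using uafw_linear_rate[OF assms(16,7) True z, of k]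
      unfolding fstar assms(18) progress_factor_def .
  next
    case False
    \<comment> \<open>The base of the power may be negative or zero here, but both gaps vanish.\<close>
    then have single: "\<And>u. u \<in> S + T \<Longrightarrow> u = z" using \<mu>\<eta>_le_1 z(1) by blast
    obtain V w where
      step: "\<And>k. uafw_step T S f \<eta> (x k) (V k) (w k) (y k) (x (Suc k)) (V (Suc k)) (w (Suc k))"
      and rep: "\<And>k. active_rep S (V k) (w k) (PS (x k))"
      using uafw_sequence_active_rep[OF assms(16,7)] by metis
    have "y k \<in> S + T" for k using uafw_step_progress[OF step rep] by metis
    then have "y k = z" for k using single by blast
    then show ?thesis by (simp add: fstar)
  qed
qed

end
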